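(* (1) For any $\alpha\ge 0$, the function $H_\alpha:[1,+\infty)\to[1,+\infty)$ defined by $$H_\alpha(t)=\begin{cases} t^{1/2}(\log t)^{\alpha}, & t\ge 3,\\ 1, & \text{otherwise,}\end{cases}$$ is a universal upper-class normalization if and only if $\alpha>3/2$. (2) For any $\beta\ge 0$, the function $H_{3/2,\beta}:[1,+\infty)\to[1,+\infty)$ defined by $$H_{3/2,\beta}(t)=\begin{cases} t^{1/2}(\log t)^{3/2}(\log\log t)^{\beta}, & t\ge 16,\\ 1, & \text{otherwise,}\end{cases}$$ is a universal upper-class normalization if and only if $\beta>1/2$. Moreover, at and below either threshold, a counterexample of rigid form exists: if $H=H_\alpha$ with $0\le\alpha\le 3/2$, or $H=H_{3/2,\beta}$ with $0\le\beta\le 1/2$, then there exists a rigid counterexample for $H$.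
   Context: $\mathbb N=\{1,2,3,\dots\}$ and $\log$ is the natural logarithm. Admissible system. Let $(X,\Omega,\mu)$ be a finite measure space with $0<\mu(X)<+\infty$, let $\mathbf F=(F_k)_{k\in\mathbb N}$ be a sequence of non-negative real-valued $\Omega$-measurable functions on $X$, and let $\mathbf f=(f_k)_{k\in\mathbb N}$, $\mathbf g=(g_k)_{k\in\mathbb N}$ be sequences of non-negative real numbers. For $N\in\mathbb N$ put $$\Phi(N)=\sum_{k=1}^N g_k,\qquad D_N(x)=\sum_{k=1}^N\bigl(F_k(x)-f_k\bigr)\quad(x\in X).$$ The sextuple $(X,\Omega,\mu,\mathbf F,\mathbf f,\mathbf g)$ is an admissible system if: (a) $0\le f_k\le g_k$ for all $k\in\mathbb N$; (b) $\lim_{N\to\infty}\Phi(N)=+\infty$; (c) there exists $K>0$ such that for any $m,n\in\mathbb N$ with $m<n$, $$\int_X\bigl(D_n(x)-D_m(x)\bigr)^2\,\mu(\mathrm dx)\le K\bigl(\Phi(n)-\Phi(m)\bigr).$$ Universal upper-class normalization. A non-decreasing function $H:[1,+\infty)\to[1,+\infty)$ is a universal upper-class normalization if for any admissible system $(X,\Omega,\mu,\mathbf F,\mathbf f,\mathbf g)$ and for $\mu$-almost every $x\in X$, as $N\to+\infty$, $$D_N(x)=O_x\Bigl(H(\Phi(N)+1)+\max_{k\le N}f_k+1\Bigr).$$ The exceptional null set may depend on the admissible system, and the implied constant may depend on both the admissible system and the point $x$. Rigid counterexample. For a non-decreasing $H:[1,+\infty)\to[1,+\infty)$, a rigid counterexample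 for $H$ is an admissible system $(X,\Omega,\mu,\mathbf F,\mathbf f,\mathbf g)$ with $X=[0,1]$, $\Omega$ the Borel $\sigma$-algebra of $[0,1]$, $\mu$ the Lebesgue measure on $[0,1]$, $f_k=1/2$ and $g_k=1$ for all $k\in\mathbb N$, such that: (i) for any $k\in\mathbb N$, $0\le F_k\le1$ and $f_k=\int_X F_k(x)\,\mu(\mathrm dx)$; (ii) there exists $K>0$ such that for any $m,n\in\mathbb N$ with $m<n$, $\int_X\bigl(\sum_{m<k\le n}(F_k(x)-f_k)\bigr)^2\,\mu(\mathrm dx)=K(n-m)$; (iii) for $\mu$-almost every $x\in[0,1]$, $$\limsup_{N\to\infty}\frac{|D_N(x)|}{H(\Phi(N)+1)+\max_{k\le N}f_k+1}=+\infty.$$ *)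

theory Defs
  imports "HOL-Analysis.Analysis" "HOL-Library.Landau_Symbols"
begin

text \<open>
  Sequences are indexed by the positive integers; they are rendered as functions on \<^typ>\<open>nat\<close>
  whose value at \<open>0\<close> is never constrained or used.
\<close>

definition Phi :: "(nat \<Rightarrow> real) \<Rightarrow> nat \<Rightarrow> real" where
  "Phi g N = (\<Sum>k = 1..N. g k)"

definition Dev :: "(nat \<Rightarrow> 'a \<Rightarrow> real) \<Rightarrow> (nat \<Rightarrow> real) \<Rightarrow> nat \<Rightarrow> 'a \<Rightarrow> real" where
  "Dev F f N x = (\<Sum>k = 1..N. F k x - f k)"

text \<open>
  The second-moment bound uses the extended non-negative integral, so that it cannot hold vacuously
  when the square is not integrable.
\<close>

locale admissible_system = finite_measure M
  for M :: "'a measure" +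
  fixes F :: "nat \<Rightarrow> 'a \<Rightarrow> real" and f g :: "nat \<Rightarrow> real"
  assumes measure_pos: "0 < measure M (space M)"
    and F_measurable: "\<And>k. k \<ge> 1 \<Longrightarrow> F k \<in> borel_measurable M"
    and F_nonneg: "\<And>k x. k \<ge> 1 \<Longrightarrow> x \<in> space M \<Longrightarrow> 0 \<le> F k x"
    and f_g_bounds: "\<And>k. k \<ge> 1 \<Longrightarrow> 0 \<le> f k \<and> f k \<le> g k"
    and Phi_at_top: "filterlim (Phi g) at_top sequentially"
    and second_moment: "\<exists>K>0. \<forall>m n. 1 \<le> m \<and> m < n \<longrightarrow>
      (\<integral>\<^sup>+x. ennreal ((Dev F f n x - Dev F f m x)\<^sup>2) \<partial>M) \<le> ennreal (K * (Phi g n - Phi g m))"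

text \<open>
  Functions from \<open>[1, \<infinity>)\<close> to itself are total functions on the reals, of which only the
  restriction to \<open>[1, \<infinity>)\<close> matters.
\<close>

definition nondecreasing_normalization :: "(real \<Rightarrow> real) \<Rightarrow> bool" where
  "nondecreasing_normalization H \<longleftrightarrow> mono_on {1..} H \<and> H \<in> {1..} \<rightarrow> {1..}"

definition envelope :: "(real \<Rightarrow> real) \<Rightarrow> (nat \<Rightarrow> real) \<Rightarrow> (nat \<Rightarrow> real) \<Rightarrow> nat \<Rightarrow> real" where
  "envelope H f g N = H (Phi g N + 1) + Max (f ` {1..N}) + 1"

text \<open>
  A formula cannot quantify over types, so the carrier type of the admissible systems is a
  parameter. Universality in the unrestricted sense is universality for every type \<open>'a\<close>.
\<close>

definition universal_upper_class :: "'a itself \<Rightarrow> (real \<Rightarrow> real) \<Rightarrow> bool" where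
  "universal_upper_class TYPE('a) H \<longleftrightarrow>
     nondecreasing_normalization H \<and>
     (\<forall>(M :: 'a measure) F f g. admissible_system M F f g \<longrightarrow>
        (AE x in M. (\<lambda>N. Dev F f N x) \<in> O[sequentially](envelope H f g)))"

definition rigid_counterexample ::
    "(real \<Rightarrow> real) \<Rightarrow> real measure \<Rightarrow> (nat \<Rightarrow> real \<Rightarrow> real) \<Rightarrow> (nat \<Rightarrow> real) \<Rightarrow> (nat \<Rightarrow> real) \<Rightarrow> bool" where
  "rigid_counterexample H M F f g \<longleftrightarrow>
     nondecreasing_normalization H \<and>
     admissible_system M F f g \<and>
     M = restrict_space lborel {0..1} \<and>
     (\<forall>k\<ge>1. f k = 1/2 \<and> g k = 1) \<and>
     (\<forall>k\<ge>1. (\<forall>x\<in>space M. 0 \<le> F k x \<and> F k x \<le> 1) \<and> f k = (\<integral>x. F k x \<partial>M)) \<and>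
     (\<exists>K>0. \<forall>m n. 1 \<le> m \<and> m < n \<longrightarrow>
        (\<integral>x. (\<Sum>k\<in>{m<..n}. F k x - f k)\<^sup>2 \<partial>M) = K * (real n - real m)) \<and>
     (AE x in M. limsup (\<lambda>N. ereal (\<bar>Dev F f N x\<bar> / envelope H f g N)) = \<infinity>)"

definition H_log :: "real \<Rightarrow> real \<Rightarrow> real" where
  "H_log \<alpha> t = (if t \<ge> 3 then t powr (1/2) * ln t powr \<alpha> else 1)"

definition H_loglog :: "real \<Rightarrow> real \<Rightarrow> real" where
  "H_loglog \<beta> t = (if t \<ge> 16 then t powr (1/2) * ln t powr (3/2) * ln (ln t) powr \<beta> else 1)"

end

theory Submission
  imports Defs "HOL-Library.Discrete_Functions"
begin

text \<open>
  Both halves of the theorem come from the same series,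
  \<open>\<Sum>j. 2 ^ j * j\<^sup>2 / (H (2 ^ j))\<^sup>2\<close>, which for \<open>H_log \<alpha>\<close> is comparable to \<open>\<Sum>j. j powr (2 - 2 * \<alpha>)\<close>
  and for \<open>H_loglog \<beta>\<close> to \<open>\<Sum>j. 1 / (j * ln j powr (2 * \<beta>))\<close>. It converges exactly when \<open>\<alpha> > 3/2\<close>,
  respectively \<open>\<beta> > 1/2\<close>.

  \<^emph>\<open>Convergence.\<close> The moment hypothesis bounds increments of the deviation by increments of \<open>Phi\<close>, so
  the deviation is sampled at the indices where \<open>Phi\<close> passes an integer. The dyadic chaining
  argument of Rademacher and Menshov (\<open>dyadic_chaining\<close>) bounds the mean square of the maximum over
  the levels up to \<open>2 ^ j\<close> by a constant times \<open>2 ^ j * j\<^sup>2\<close>. Hence the series above controls the sum over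
  \<open>j\<close> of these maxima divided by \<open>(H (2 ^ j))\<^sup>2\<close>, and almost surely each maximum is \<open>O (H (2 ^ j))\<close>.
  Between two consecutive levels the non-negativity of the \<open>F k\<close> leaves only an error
  \<open>max f + 1\<close> (\<open>Dev_sandwich\<close>).

  \<^emph>\<open>Divergence.\<close> One system defeats \<open>H_loglog (1/2)\<close>, and thereby all the other normalizations at or
  below the thresholds, since on \<open>{16..}\<close> none of them is larger. It consists of independent blocks. Block
  number \<open>j\<close> has about \<open>n = 4 ^ j * M\<close> bounded orthonormal functions that are arranged as
  \<open>L = 2 ^ Suc j\<close> consecutive groups of \<open>R = L * M\<close> functions. On an event \<open>A\<close> of probability
  \<open>1 / M\<close>, a sum over a whole group is \<open>R\<close> times an entry of the matrix with entries
  proportional to \<open>1 / sin (pi * (i - t + 1/2) / L)\<close>, a discrete Hilbert transform. This matrix is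
  orthogonal although its entries decay only like \<open>1 / (i - t)\<close>, so on half of \<open>A\<close> some partial
  sum is as large as \<open>R * ln L\<close>, which is comparable to \<open>sqrt (n * M) * ln n\<close>. The entries are so
  small that the functions carrying them have mean square \<open>1 / R\<close> only; bounded Walsh functions, which
  cancel within each group, are added to make the system orthonormal. With
  \<open>M\<close> slightly larger than \<open>j * ln j\<close>, but such that the sum of the probabilities \<open>1 / (2 * M)\<close> still
  diverges, the second Borel-Cantelli lemma makes large partial sums happen in infinitely many
  blocks, and there \<open>sqrt (n * M) * ln n\<close> exceeds every multiple of \<open>H_loglog (1/2) n\<close>.
\<close>

section \<open>The Rademacher-Menshov bound on dyadic levels\<close>

text \<open>
  The point \<open>v\<close> is reached from \<open>0\<close> through its truncated binary expansions, one jump per dyadic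
  scale. At each scale the jump that is used is bounded by the root of the sum of squares of all
  jumps of that scale. The induction removes the finest scale by passing to the even-indexed points.
\<close>

lemma dyadic_chaining_abs:
  fixes y :: "nat \<Rightarrow> real"
  assumes "v \<le> 2 ^ j"
  shows "\<bar>y v - y 0\<bar> \<le> (\<Sum>i\<le>j. sqrt (\<Sum>a<2 ^ (j - i). (y ((a + 1) * 2 ^ i) - y (a * 2 ^ i))\<^sup>2))"
  using assms
proof (induction j arbitrary: y v)
  case 0
  then have "v = 0 \<or> v = 1" by auto
  then show ?case by auto
next
  case (Suc j)
  define w where "w = v div 2"
  have w: "w \<le> 2 ^ j" using Suc.prems unfolding w_def by auto
  let ?m = "\<lambda>i. sqrt (\<Sum>a<2 ^ (Suc j - i). (y ((a + 1) * 2 ^ i) - y (a * 2 ^ i))\<^sup>2)"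
  have "\<bar>y v - y (2 * w)\<bar> \<le> ?m 0"
  proof (cases "even v")
    case True
    then show ?thesis unfolding w_def by (simp add: sum_nonneg)
  next
    case False
    then have v: "v = 2 * w + 1" unfolding w_def by simp
    then have "2 * w < 2 ^ Suc j" using Suc.prems by linarith
    then have "(y v - y (2 * w))\<^sup>2 \<le> (\<Sum>a<2 ^ Suc j. (y (a + 1) - y a)\<^sup>2)"
      using member_le_sum[of "2*w" "{..<2 ^ Suc j}" "\<lambda>a. (y (a + 1) - y a)\<^sup>2"] v by simp
    then show ?thesis by (simp add: real_le_rsqrt)
  qed
  moreover have "\<bar>y (2 * w) - y 0\<bar> \<le> (\<Sum>i\<le>j. ?m (Suc i))"
    using Suc.IH[OF w, of "\<lambda>k. y (2 * k)"] by (simp add: mult.left_commute mult.commute)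
  moreover have "(\<Sum>i\<le>Suc j. ?m i) = ?m 0 + (\<Sum>i\<le>j. ?m (Suc i))"
    by (rule sum.atMost_Suc_shift)
  ultimately show ?case by linarith
qed

text \<open>
  The Cauchy-Schwarz inequality over the \<open>j + 1\<close> scales. It is this factor, together with the
  number of scales in the sum, that produces the two logarithms of the Rademacher-Menshov theorem.
\<close>

lemma dyadic_chaining:
  fixes y :: "nat \<Rightarrow> real"
  assumes "v \<le> 2 ^ j"
  shows "(y v - y 0)\<^sup>2 \<le> real (j + 1) * (\<Sum>i\<le>j. \<Sum>a<2 ^ (j - i). (y ((a + 1) * 2 ^ i) - y (a * 2 ^ i))\<^sup>2)"
proof -
  let ?q = "\<lambda>i. \<Sum>a<2 ^ (j - i). (y ((a + 1) * 2 ^ i) - y (a * 2 ^ i))\<^sup>2"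
  have "(y v - y 0)\<^sup>2 \<le> (\<Sum>i\<le>j. sqrt (?q i))\<^sup>2"
    using power_mono[OF dyadic_chaining_abs[OF assms, of y], of 2] by simp
  also have "\<dots> \<le> (\<Sum>i\<le>j. (sqrt (?q i))\<^sup>2) * real (card {..j})"
    by (rule sum_squared_le_sum_of_squares) 
  also have "(\<Sum>i\<le>j. (sqrt (?q i))\<^sup>2) = (\<Sum>i\<le>j. ?q i)"
    by (intro sum.cong refl real_sqrt_pow2 sum_nonneg) auto
  finally show ?thesis by (simp add: mult.commute)
qed

lemma Phi_mono:
  assumes "\<And>k. k \<ge> 1 \<Longrightarrow> 0 \<le> g k" "m \<le> n"
  shows "Phi g m \<le> Phi g n"
  unfolding Phi_def using assms by (intro sum_mono2) auto

lemma Phi_diff: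
  assumes "m \<le> n" shows "Phi g n - Phi g m = (\<Sum>k\<in>{m<..n}. g k)"
proof -
  have "{1..n} = {1..m} \<union> {m<..n}" using assms by auto
  then have "Phi g n = Phi g m + (\<Sum>k\<in>{m<..n}. g k)"
    unfolding Phi_def by (simp only:) (rule sum.union_disjoint; auto)
  then show ?thesis by simp
qed

lemma Dev_eq_Phi: "Dev F f N x = Phi (\<lambda>k. F k x - f k) N"
  by (simp add: Dev_def Phi_def)

context admissible_system
begin

lemma g_nonneg: "k \<ge> 1 \<Longrightarrow> 0 \<le> g k"
  using f_g_bounds by force

text \<open>
  The index at which \<open>Phi g\<close> is about to reach the level \<open>u + 1\<close>, but at least \<open>1\<close>, because
  the second-moment condition only speaks of increments that start at a positive index.
\<close>

definition level_index :: "nat \<Rightarrow> nat" where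
  "level_index u = (LEAST N. N \<ge> 1 \<and> Phi g (N + 1) \<ge> real u + 1)"

lemma level_index: "level_index u \<ge> 1 \<and> Phi g (level_index u + 1) \<ge> real u + 1"
proof -
  have "eventually (\<lambda>N. Phi g N \<ge> real u + 1) sequentially"
    using Phi_at_top by (simp add: filterlim_at_top)
  then obtain N0 where "\<And>N. N \<ge> N0 \<Longrightarrow> Phi g N \<ge> real u + 1"
    by (auto simp: eventually_sequentially)
  then have "\<exists>N. N \<ge> 1 \<and> Phi g (N + 1) \<ge> real u + 1"
    by (intro exI[of _ "N0 + 1"]) auto
  then show ?thesis unfolding level_index_def by (rule LeastI_ex)
qed

text \<open>
  The index \<open>1\<close> has to be excluded: \<open>Phi g 1\<close> may already exceed many levels, which then all
  have level index \<open>1\<close>.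
\<close>

lemma Phi_less_level:
  assumes "2 \<le> N" "N \<le> level_index u"
  shows "Phi g N < real u + 1"
proof -
  have "N - 1 < (LEAST N. N \<ge> 1 \<and> Phi g (N + 1) \<ge> real u + 1)"
    using assms unfolding level_index_def by linarith
  from not_less_Least[OF this] have "\<not> (1 \<le> N - 1 \<and> real u + 1 \<le> Phi g (N - 1 + 1))" .
  moreover have "1 \<le> N - 1" "N - 1 + 1 = N" using assms by auto
  ultimately show ?thesis by (metis not_le)
qed

lemma level_index_mono: "u \<le> v \<Longrightarrow> level_index u \<le> level_index v"
  unfolding level_index_def[of u]
  by (intro Least_le) (use level_index[of v] in auto)

lemma level_total_mass: "Phi g (level_index J) - Phi g (level_index 0) \<le> real J + 1"
proof (cases "level_index J = 1")
  case True
  then have "level_index 0 = 1" using level_index_mono[of 0 J] level_index[of 0] by simp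
  then show ?thesis using True by simp
next
  case False
  then have "Phi g (level_index J) < real J + 1"
    using level_index[of J] by (intro Phi_less_level) auto
  moreover have "Phi g (level_index 0) \<ge> 0"
    unfolding Phi_def by (intro sum_nonneg) (simp add: g_nonneg)
  ultimately show ?thesis by simp
qed

lemma Dev_measurable [measurable]: "Dev F f N \<in> borel_measurable M"
proof -
  have "(\<lambda>x. Dev F f N x) \<in> borel_measurable M"
    unfolding Dev_def by (intro borel_measurable_sum borel_measurable_diff F_measurable) auto
  then show ?thesis by simp
qed

definition chain_square :: "nat \<Rightarrow> 'a \<Rightarrow> real" where
  "chain_square J x = (\<Sum>i\<le>J. \<Sum>a<2 ^ (J - i).
     (Dev F f (level_index ((a + 1) * 2 ^ i)) x - Dev F f (level_index (a * 2 ^ i)) x)\<^sup>2)"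

lemma chain_square_measurable [measurable]: "chain_square J \<in> borel_measurable M"
proof -
  have "(\<lambda>x. chain_square J x) \<in> borel_measurable M"
    unfolding chain_square_def by measurable
  then show ?thesis by simp
qed

lemma chain_square_nonneg: "chain_square J x \<ge> 0"
  unfolding chain_square_def by (intro sum_nonneg) simp

text \<open>
  On each of the \<open>J + 1\<close> scales the second-moment bounds of consecutive jumps telescope to the increment
  of \<open>Phi g\<close> over all levels, at most \<open>2 ^ J + 1\<close>.
\<close>

lemma nn_integral_chain_square:
  "\<exists>K>0. \<forall>J. (\<integral>\<^sup>+x. ennreal (chain_square J x) \<partial>M) \<le> ennreal (K * (real (J + 1) * (2 ^ J + 1)))"
proof -
  obtain K where K: "K > 0" and mom: "\<And>m n. 1 \<le> m \<Longrightarrow> m < n \<Longrightarrow>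
      (\<integral>\<^sup>+x. ennreal ((Dev F f n x - Dev F f m x)\<^sup>2) \<partial>M) \<le> ennreal (K * (Phi g n - Phi g m))"
    using second_moment by blast
  have mom': "(\<integral>\<^sup>+x. ennreal ((Dev F f n x - Dev F f m x)\<^sup>2) \<partial>M) \<le> ennreal (K * (Phi g n - Phi g m))"
    if "1 \<le> m" "m \<le> n" for m n
    using mom[of m n] that by (cases "m = n") auto
  have "(\<integral>\<^sup>+x. ennreal (chain_square J x) \<partial>M) \<le> ennreal (K * (real (J + 1) * (2 ^ J + 1)))" for J
  proof -
    let ?n = level_index
    let ?P = "\<lambda>i a. Phi g (?n ((a + 1) * 2 ^ i)) - Phi g (?n (a * 2 ^ i))"
    have P0: "?P i a \<ge> 0" for i a
      using Phi_mono[OF g_nonneg level_index_mono[of "a * 2 ^ i" "(a + 1) * 2 ^ i"]] by simp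
    have "(\<integral>\<^sup>+x. ennreal (chain_square J x) \<partial>M)
        = (\<Sum>i\<le>J. \<Sum>a<2 ^ (J - i). \<integral>\<^sup>+x. ennreal ((Dev F f (?n ((a + 1) * 2 ^ i)) x - Dev F f (?n (a * 2 ^ i)) x)\<^sup>2) \<partial>M)"
      unfolding chain_square_def
      by (simp add: nn_integral_sum sum_nonneg flip: sum_ennreal)
    also have "\<dots> \<le> (\<Sum>i\<le>J. \<Sum>a<2 ^ (J - i). ennreal (K * ?P i a))"
      using level_index by (intro sum_mono mom') (auto intro: level_index_mono)
    also have "\<dots> = ennreal (\<Sum>i\<le>J. \<Sum>a<2 ^ (J - i). K * ?P i a)"
      using K P0 by (simp add: sum_ennreal sum_nonneg)
    also have "(\<Sum>i\<le>J. \<Sum>a<2 ^ (J - i). K * ?P i a) \<le> (\<Sum>i\<le>J. K * (2 ^ J + 1))"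
    proof (intro sum_mono)
      fix i assume i: "i \<in> {..J}"
      have "(\<Sum>a<2 ^ (J - i). ?P i a) = Phi g (?n (2 ^ (J - i) * 2 ^ i)) - Phi g (?n 0)"
        using sum_lessThan_telescope[of "\<lambda>a. Phi g (?n (a * 2 ^ i))" "2 ^ (J - i)"] by simp
      also have "(2::nat) ^ (J - i) * 2 ^ i = 2 ^ J"
        using i by (simp flip: power_add)
      also have "Phi g (?n (2 ^ J)) - Phi g (?n 0) \<le> 2 ^ J + 1"
        using level_total_mass[of "2 ^ J"] by simp
      finally show "(\<Sum>a<2 ^ (J - i). K * ?P i a) \<le> K * (2 ^ J + 1)"
        using K by (simp flip: sum_distrib_left)
    qed
    then have "ennreal (\<Sum>i\<le>J. \<Sum>a<2 ^ (J - i). K * ?P i a) \<le> ennreal (\<Sum>i\<le>J. K * (2 ^ J + 1))"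
      by (rule ennreal_leI)
    also have "(\<Sum>i\<le>J. K * (2 ^ J + 1)) = K * (real (J + 1) * (2 ^ J + 1))"
      by (simp add: algebra_simps)
    finally show ?thesis .
  qed
  then show ?thesis using K by blast
qed

text \<open>
  Since \<open>F k \<ge> 0\<close>, the deviation decreases over a stretch of indices by at most the sum of the
  \<open>f k\<close> there. Comparing \<open>N\<close> with the end of its own level bounds the deviation from above.
  Comparing it with the end of the previous level bounds it from below; the one jump into the
  current level may be large, and it is this jump that costs \<open>Max (f ` {1..N})\<close>.
\<close>

lemma Dev_sandwich:
  assumes x: "x \<in> space M" and N: "2 \<le> N" and Phi_N: "1 \<le> Phi g N"
  defines "u \<equiv> nat \<lfloor>Phi g N\<rfloor>"
  shows "\<bar>Dev F f N x\<bar> \<le> max \<bar>Dev F f (level_index u) x\<bar> \<bar>Dev F f (level_index (u - 1)) x\<bar>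
           + Max (f ` {1..N}) + 1"
proof -
  have u: "1 \<le> u" "real u \<le> Phi g N" "Phi g N < real u + 1"
    using Phi_N unfolding u_def by linarith+
  let ?a = "level_index u" and ?b = "level_index (u - 1)"
  have a: "N \<le> ?a"
  proof (rule ccontr)
    assume "\<not> N \<le> ?a"
    then have "Phi g (?a + 1) \<le> Phi g N" by (intro Phi_mono) (auto simp: g_nonneg)
    then show False using level_index[of u] u by simp
  qed
  have b: "?b < N"
    using Phi_less_level[OF N, of "u - 1"] u by (cases "?b < N") (auto simp: of_nat_diff)
  have Dev_ge: "Dev F f n x - Dev F f m x \<ge> - (\<Sum>k\<in>{m<..n}. f k)" if "m \<le> n" for m n
  proof -
    have "Dev F f n x - Dev F f m x = (\<Sum>k\<in>{m<..n}. F k x - f k)"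
      using Phi_diff[OF that] by (simp add: Dev_eq_Phi)
    also have "\<dots> \<ge> (\<Sum>k\<in>{m<..n}. - f k)"
      using F_nonneg x by (intro sum_mono) auto
    finally show ?thesis by (simp add: sum_negf)
  qed
  have f_le: "(\<Sum>k\<in>{m<..n}. f k) \<le> Phi g n - Phi g m" if "m \<le> n" for m n
    unfolding Phi_diff[OF that] using f_g_bounds by (intro sum_mono) auto
  have f_max: "f k \<le> Max (f ` {1..N})" if "1 \<le> k" "k \<le> N" for k
    using that by (intro Max_ge) auto
  have max_nonneg: "Max (f ` {1..N}) \<ge> 0"
  proof -
    have "0 \<le> f 1" using f_g_bounds[of 1] by simp
    also have "\<dots> \<le> Max (f ` {1..N})" using N by (intro f_max) auto
    finally show ?thesis .
  qed
  have "Phi g ?a < real u + 1" using a N by (intro Phi_less_level) auto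
  then have "Dev F f N x \<le> Dev F f ?a x + 1"
    using Dev_ge[OF a] f_le[OF a] u by linarith
  moreover have "Dev F f N x \<ge> Dev F f ?b x - (Max (f ` {1..N}) + 1)"
  proof -
    have "{?b<..N} = insert (?b + 1) {?b + 1<..N}" using b by auto
    then have "(\<Sum>k\<in>{?b<..N}. f k) = f (?b + 1) + (\<Sum>k\<in>{?b + 1<..N}. f k)" by simp
    also have "\<dots> \<le> Max (f ` {1..N}) + (Phi g N - Phi g (?b + 1))"
      using b f_le[of "?b + 1" N] by (intro add_mono f_max) auto
    also have "\<dots> \<le> Max (f ` {1..N}) + 1"
      using level_index[of "u - 1"] u by (simp add: of_nat_diff)
    finally show ?thesis using Dev_ge[of ?b N] b by simp
  qed
  ultimately show ?thesis using max_nonneg by linarith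
qed

text \<open>
  Weighting the chained squares by \<open>1 / (H (2 ^ j))\<^sup>2\<close> gives a series with finite integral, so its terms
  are almost surely bounded.
\<close>

theorem AE_Dev_bigo:
  assumes H: "nondecreasing_normalization H"
    and summable: "summable (\<lambda>j. 2 ^ j * (real j + 1)\<^sup>2 / (H (2 ^ j))\<^sup>2)"
  shows "AE x in M. (\<lambda>N. Dev F f N x) \<in> O[sequentially](envelope H f g)"
proof -
  have H': "mono_on {1..} H" "H \<in> {1..} \<rightarrow> {1..}"
    using H unfolding nondecreasing_normalization_def by blast+
  have H_ge: "H t \<ge> 1" if "t \<ge> 1" for t
    using funcset_mem[OF H'(2), of t] that by simp
  have H_mono: "H s \<le> H t" if "1 \<le> s" "s \<le> t" for s t
    using that by (intro mono_onD[OF H'(1)]) auto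
  from nn_integral_chain_square obtain K where K: "K > 0" and chain: "\<And>J. (\<integral>\<^sup>+x. ennreal (chain_square J x) \<partial>M)
      \<le> ennreal (K * (real (J + 1) * (2 ^ J + 1)))"
    by metis
  \<comment> \<open>The indices \<open>N\<close> with \<open>2 ^ j \<le> \<lfloor>Phi g N\<rfloor> < 2 ^ Suc j\<close> are controlled by the chain of length
    \<open>2 ^ Suc j\<close>, while \<open>H\<close> is evaluated at the left end \<open>2 ^ j\<close>, where it is smallest.\<close>
  define c where "c j = (real j + 2) / (H (2 ^ j))\<^sup>2" for j :: nat
  have c: "c j \<ge> 0" for j by (simp add: c_def)
  let ?b = "\<lambda>j. 2 ^ j * (real j + 1)\<^sup>2 / (H (2 ^ j))\<^sup>2"
  have step: "(\<integral>\<^sup>+x. ennreal (c j * chain_square (Suc j) x) \<partial>M) \<le> ennreal (12 * K * ?b j)" for j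
  proof -
    have "(\<integral>\<^sup>+x. ennreal (c j * chain_square (Suc j) x) \<partial>M)
        = ennreal (c j) * (\<integral>\<^sup>+x. ennreal (chain_square (Suc j) x) \<partial>M)"
      using c by (subst nn_integral_cmult[symmetric]) (auto simp: ennreal_mult chain_square_nonneg)
    also have "\<dots> \<le> ennreal (c j) * ennreal (K * ((real j + 2) * (2 ^ Suc j + 1)))"
    proof (intro mult_left_mono)
      have "real (Suc j + 1) = real j + 2" by simp
      then show "(\<integral>\<^sup>+x. ennreal (chain_square (Suc j) x) \<partial>M) \<le> ennreal (K * ((real j + 2) * (2 ^ Suc j + 1)))"
        using chain[of "Suc j"] by metis
    qed simp
    also have "\<dots> = ennreal (c j * (K * ((real j + 2) * (2 ^ Suc j + 1))))"
      by (rule ennreal_mult[symmetric]) (use c K in auto)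
    also have "c j * (K * ((real j + 2) * (2 ^ Suc j + 1))) \<le> 12 * K * ?b j"
    proof -
      have "(real j + 2) * ((real j + 2) * (2 ^ Suc j + 1)) \<le> (2 * (real j + 1)) * ((2 * (real j + 1)) * (3 * 2 ^ j))"
        by (intro mult_mono) auto
      also have "\<dots> = 12 * (2 ^ j * (real j + 1)\<^sup>2)" by (simp add: power2_eq_square algebra_simps)
      finally have "(real j + 2) * ((real j + 2) * (2 ^ Suc j + 1)) * (K / (H (2 ^ j))\<^sup>2)
          \<le> 12 * (2 ^ j * (real j + 1)\<^sup>2) * (K / (H (2 ^ j))\<^sup>2)"
        using K by (intro mult_right_mono) auto
      moreover have "c j * (K * ((real j + 2) * (2 ^ Suc j + 1)))
          = (real j + 2) * ((real j + 2) * (2 ^ Suc j + 1)) * (K / (H (2 ^ j))\<^sup>2)"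
        by (simp add: c_def)
      moreover have "12 * (2 ^ j * (real j + 1)\<^sup>2) * (K / (H (2 ^ j))\<^sup>2) = 12 * K * ?b j"
        by simp
      ultimately show ?thesis by metis
    qed
    then have "ennreal (c j * (K * ((real j + 2) * (2 ^ Suc j + 1)))) \<le> ennreal (12 * K * ?b j)"
      by (rule ennreal_leI)
    finally show ?thesis .
  qed
  have "(\<integral>\<^sup>+x. (\<Sum>j. ennreal (c j * chain_square (Suc j) x)) \<partial>M)
      = (\<Sum>j. \<integral>\<^sup>+x. ennreal (c j * chain_square (Suc j) x) \<partial>M)"
    by (rule nn_integral_suminf) measurable
  also have "\<dots> \<le> (\<Sum>j. ennreal (12 * K * ?b j))"
    by (intro suminf_le step) auto
  also have "\<dots> < \<infinity>"
    using K summable_mult[OF summable, of "12 * K"] by (subst suminf_ennreal2) auto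
  finally have "(\<integral>\<^sup>+x. (\<Sum>j. ennreal (c j * chain_square (Suc j) x)) \<partial>M) \<noteq> \<infinity>" by simp
  then have "AE x in M. (\<Sum>j. ennreal (c j * chain_square (Suc j) x)) \<noteq> \<infinity>"
    by (intro nn_integral_PInf_AE) auto
  with AE_space show ?thesis
  proof eventually_elim
    fix x assume x: "x \<in> space M" and fin: "(\<Sum>j. ennreal (c j * chain_square (Suc j) x)) \<noteq> \<infinity>"
    from fin obtain C where C: "C \<ge> 0" "(\<Sum>j. ennreal (c j * chain_square (Suc j) x)) = ennreal C"
      by (cases "(\<Sum>j. ennreal (c j * chain_square (Suc j) x))") auto
    have each: "c j * chain_square (Suc j) x \<le> C" for j
    proof -
      have "ennreal (c j * chain_square (Suc j) x) \<le> (\<Sum>j. ennreal (c j * chain_square (Suc j) x))"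
        using sum_le_suminf[of "\<lambda>j. ennreal (c j * chain_square (Suc j) x)" "{j}"] by simp
      then show ?thesis using C by simp
    qed
    let ?y = "\<lambda>v. Dev F f (level_index v) x"
    have level: "\<bar>?y v\<bar> \<le> \<bar>?y 0\<bar> + sqrt C * H (2 ^ j)" if "v \<le> 2 ^ Suc j" for v j
    proof -
      have "(?y v - ?y 0)\<^sup>2 \<le> (real j + 2) * chain_square (Suc j) x"
        using dyadic_chaining[OF that, of ?y] by (simp add: chain_square_def add.commute)
      also have "\<dots> = c j * chain_square (Suc j) x * (H (2 ^ j))\<^sup>2"
        using H_ge[of "2 ^ j"] by (simp add: c_def)
      also have "\<dots> \<le> C * (H (2 ^ j))\<^sup>2"
        using each by (intro mult_right_mono) auto
      finally have "\<bar>?y v - ?y 0\<bar> \<le> sqrt (C * (H (2 ^ j))\<^sup>2)"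
        by (metis real_sqrt_le_mono real_sqrt_abs)
      also have "\<dots> = sqrt C * H (2 ^ j)"
        using H_ge[of "2 ^ j"] by (simp add: real_sqrt_mult)
      finally show ?thesis by linarith
    qed
    have bound: "\<bar>Dev F f N x\<bar> \<le> (\<bar>?y 0\<bar> + sqrt C + 1) * envelope H f g N"
      if N: "2 \<le> N" and Phi_N: "1 \<le> Phi g N" for N
    proof -
      define u where "u = nat \<lfloor>Phi g N\<rfloor>"
      have u: "1 \<le> u" "real u \<le> Phi g N" using Phi_N unfolding u_def by linarith+
      define j where "j = floor_log u"
      have j: "2 ^ j \<le> u" "u < 2 ^ Suc j"
        using u floor_log_exp2_le[of u] floor_log_exp2_gt[of u] by (auto simp: j_def)
      have Hj: "H (2 ^ j) \<le> H (Phi g N + 1)"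
      proof (rule H_mono)
        have "(2::real) ^ j \<le> real u" using of_nat_mono[OF j(1), where 'a = real] by simp
        then show "(2::real) ^ j \<le> Phi g N + 1" using u by linarith
      qed simp
      have H1: "H (Phi g N + 1) \<ge> 1" using Phi_N by (intro H_ge) simp
      have fN: "Max (f ` {1..N}) \<ge> 0"
      proof -
        have "f 1 \<le> Max (f ` {1..N})" using N by (intro Max_ge) auto
        then show ?thesis using f_g_bounds[of 1] by simp
      qed
      have "\<bar>Dev F f N x\<bar> \<le> \<bar>?y 0\<bar> + sqrt C * H (2 ^ j) + (Max (f ` {1..N}) + 1)"
      proof -
        have "u \<le> 2 ^ Suc j" "u - 1 \<le> 2 ^ Suc j" using j by auto
        then have "max \<bar>?y u\<bar> \<bar>?y (u - 1)\<bar> \<le> \<bar>?y 0\<bar> + sqrt C * H (2 ^ j)"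
          by (intro max.boundedI level)
        then show ?thesis using Dev_sandwich[OF x N Phi_N] unfolding u_def[symmetric] by linarith
      qed
      also have "\<dots> \<le> \<bar>?y 0\<bar> * envelope H f g N + sqrt C * envelope H f g N + envelope H f g N"
      proof (intro add_mono)
        show "\<bar>?y 0\<bar> \<le> \<bar>?y 0\<bar> * envelope H f g N"
          using mult_left_mono[of 1 "envelope H f g N" "\<bar>?y 0\<bar>"] H1 fN by (simp add: envelope_def)
        show "sqrt C * H (2 ^ j) \<le> sqrt C * envelope H f g N"
          using C Hj fN by (intro mult_left_mono) (auto simp: envelope_def)
        show "Max (f ` {1..N}) + 1 \<le> envelope H f g N"
          using H1 by (simp add: envelope_def)
      qed
      finally show ?thesis by (simp add: algebra_simps)
    qed
    have "eventually (\<lambda>N. 1 \<le> Phi g N) sequentially"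
      using Phi_at_top by (simp add: filterlim_at_top)
    then have "eventually (\<lambda>N. norm (Dev F f N x) \<le> (\<bar>?y 0\<bar> + sqrt C + 1) * norm (envelope H f g N)) sequentially"
      using eventually_ge_at_top[of 2]
    proof eventually_elim
      case (elim N)
      then have "\<bar>Dev F f N x\<bar> \<le> (\<bar>?y 0\<bar> + sqrt C + 1) * envelope H f g N"
        by (intro bound)
      also have "\<dots> \<le> (\<bar>?y 0\<bar> + sqrt C + 1) * \<bar>envelope H f g N\<bar>"
        using C by (intro mult_left_mono) auto
      finally show ?case by simp
    qed
    then show "(\<lambda>N. Dev F f N x) \<in> O[sequentially](envelope H f g)"
      by (rule bigoI)
  qed
qed

end

theorem universal_upper_class_if_summable:
  assumes "nondecreasing_normalization H"
    and "summable (\<lambda>j. 2 ^ j * (real j + 1)\<^sup>2 / (H (2 ^ j))\<^sup>2)"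
  shows "universal_upper_class TYPE('a) H"
  unfolding universal_upper_class_def
  using assms admissible_system.AE_Dev_bigo by blast

section \<open>An orthogonal matrix with logarithmic row sums\<close>

text \<open>
  The kernel of a discrete Hilbert transform on \<open>{0..<L}\<close>. The shift by \<open>1/2\<close> avoids the poles of
  the cosecant and makes the rows of the matrix with entries \<open>csc_half L (i - t)\<close> exactly orthogonal.
\<close>

definition csc_half :: "nat \<Rightarrow> int \<Rightarrow> real" where
  "csc_half L u = 1 / sin (pi * (of_int u + 1/2) / real L)"

lemma sum_periodic:
  fixes c :: "int \<Rightarrow> real"
  assumes per: "\<And>u. c (u + int L) = c u"
  shows "(\<Sum>t<L. c (int i - int t)) = (\<Sum>t<L. c (int t))"
proof (induction i)
  case 0
  have "(\<Sum>t<L. c (- int t)) = (\<Sum>t<L. c (int (Suc t)))"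
  proof -
    have "(\<Sum>t<L. c (int (Suc t))) = (\<Sum>t<L. c (int (Suc (L - Suc t))))"
      by (rule sum.nat_diff_reindex[symmetric])
    also have "\<dots> = (\<Sum>t<L. c (- int t))"
    proof (intro sum.cong refl)
      fix t assume "t \<in> {..<L}"
      then have "int (Suc (L - Suc t)) = - int t + int L" by auto
      then show "c (int (Suc (L - Suc t))) = c (- int t)" using per by metis
    qed
    finally show ?thesis by simp
  qed
  also have "(\<Sum>t<L. c (int (Suc t))) = (\<Sum>t<L. c (int t)) + (c (int L) - c 0)"
    using sum_lessThan_telescope[of "\<lambda>t. c (int t)" L] by (simp add: sum_subtractf)
  also have "c (int L) = c 0" using per[of 0] by simp
  finally show ?case by simp
next
  case (Suc i)
  have "(\<Sum>t<L. c (int (Suc i) - int t)) - (\<Sum>t<L. c (int i - int t))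
      = (\<Sum>t<L. c (int (Suc i) - int t) - c (int (Suc i) - int (Suc t)))"
    by (simp add: sum_subtractf)
  also have "\<dots> = c (int (Suc i)) - c (int (Suc i) - int L)"
    using sum_lessThan_telescope'[of "\<lambda>t. c (int (Suc i) - int t)" L] by simp
  also have "\<dots> = 0" using per[of "int (Suc i) - int L"] by simp
  finally show ?case using Suc.IH by simp
qed

lemma sin_half_nonzero:
  assumes "L > 0" shows "sin (pi * (of_int u + 1/2) / real L) \<noteq> 0"
proof
  assume "sin (pi * (of_int u + 1/2) / real L) = 0"
  then obtain k :: int where "pi * (of_int u + 1/2) / real L = of_int k * pi"
    by (auto simp: sin_zero_iff_int2)
  then have "pi * (of_int u + 1/2) = pi * (of_int k * real L)"
    using assms by (simp add: nonzero_divide_eq_eq mult_ac)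
  then have "of_int u + 1/2 = (of_int k * real L :: real)" by simp
  then have "of_int (2 * u + 1) = (of_int (2 * k * int L) :: real)" by simp
  then have "2 * u + 1 = 2 * k * int L" by (simp only: of_int_eq_iff)
  then have "even (2 * u + 1)" by simp
  then show False by simp
qed

definition csc_energy :: "nat \<Rightarrow> real" where
  "csc_energy L = (\<Sum>t<L. (csc_half L (int t))\<^sup>2)"

lemma csc_half_shift: "L > 0 \<Longrightarrow> csc_half L (u + int L) = - csc_half L u"
proof -
  assume "L > 0"
  then have "pi * (of_int (u + int L) + 1/2) / real L = pi * (of_int u + 1/2) / real L + pi"
    by (simp add: field_simps)
  then show ?thesis by (simp add: csc_half_def)
qed

lemma sum_csc_half_square:
  assumes "L > 0"
  shows "(\<Sum>t<L. (csc_half L (int i - int t))\<^sup>2) = csc_energy L"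
  unfolding csc_energy_def
  by (rule sum_periodic[of "\<lambda>u. (csc_half L u)\<^sup>2"]) (simp add: csc_half_shift assms)

text \<open>
  Because \<open>cot a - cot b = sin (b - a) / (sin a * sin b)\<close> and \<open>b - a\<close> does not depend on the column,
  the inner product of two rows is a multiple of the difference of two sums of cotangents over a
  full period, and these coincide.
\<close>

lemma sum_csc_half_orthogonal:
  assumes "i < L" "i' < L" "i \<noteq> i'"
  shows "(\<Sum>t<L. csc_half L (int i - int t) * csc_half L (int i' - int t)) = 0"
proof -
  have L: "L > 0" using assms by simp
  define ct where "ct u = cot (pi * (of_int u + 1/2) / real L)" for u :: int
  define d where "d = sin (pi * (real i' - real i) / real L)"
  have d: "d \<noteq> 0"
  proof
    assume "d = 0"
    then obtain k :: int where "pi * (real i' - real i) / real L = of_int k * pi"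
      by (auto simp: sin_zero_iff_int2 d_def)
    then have "pi * (real i' - real i) = pi * (of_int k * real L)"
      using L by (simp add: nonzero_divide_eq_eq mult_ac)
    then have "real i' - real i = of_int k * real L" by simp
    then have "of_int (int i' - int i) = (of_int (k * int L) :: real)" by simp
    then have k: "int i' - int i = k * int L" by (simp only: of_int_eq_iff)
    have "k \<noteq> 0" using k assms by auto
    then have "1 * int L \<le> \<bar>k\<bar> * int L" by (intro mult_right_mono) auto
    then have "\<bar>k * int L\<bar> \<ge> int L" by (simp add: abs_mult)
    then show False using k assms by linarith
  qed
  have per: "ct (u + int L) = ct u" for u
  proof -
    have "pi * (of_int (u + int L) + 1/2) / real L = pi * (of_int u + 1/2) / real L + pi"
      using L by (simp add: field_simps)
    then show ?thesis by (simp add: ct_def cot_def)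
  qed
  have prod_eq: "csc_half L u * csc_half L v = (ct u - ct v) / d"
    if "v - u = int i' - int i" for u v
  proof -
    let ?a = "pi * (of_int u + 1/2) / real L" and ?b = "pi * (of_int v + 1/2) / real L"
    have v: "real_of_int v = real_of_int u + (real i' - real i)" using that by linarith
    have "?b - ?a = pi * (real i' - real i) / real L"
      unfolding v by (simp add: algebra_simps flip: diff_divide_distrib add_divide_distrib)
    then have "d = sin (?b - ?a)" by (simp add: d_def)
    then have dd: "d = sin ?b * cos ?a - cos ?b * sin ?a" by (simp add: sin_diff)
    have "ct u - ct v = d / (sin ?a * sin ?b)"
      unfolding dd ct_def cot_def using sin_half_nonzero[OF L, of u] sin_half_nonzero[OF L, of v]
      by (simp add: field_simps)
    then show ?thesis using d by (simp add: csc_half_def)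
  qed
  have "(\<Sum>t<L. csc_half L (int i - int t) * csc_half L (int i' - int t))
      = (\<Sum>t<L. (ct (int i - int t) - ct (int i' - int t)) / d)"
    by (intro sum.cong refl prod_eq) simp
  also have "\<dots> = ((\<Sum>t<L. ct (int i - int t)) - (\<Sum>t<L. ct (int i' - int t))) / d"
    by (simp add: sum_subtractf flip: sum_divide_distrib)
  also have "\<dots> = 0" using sum_periodic[of ct L, OF per] by simp
  finally show ?thesis .
qed

lemma csc_half_reflect: "L > 0 \<Longrightarrow> csc_half L (int L - 1 - u) = csc_half L u"
proof -
  assume "L > 0"
  then have "pi * (of_int (int L - 1 - u) + 1/2) / real L = pi - pi * (of_int u + 1/2) / real L"
    by (simp add: field_simps)
  then show ?thesis by (simp add: csc_half_def)
qed

lemma csc_half_bounds: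
  assumes "u < L"
  shows "csc_half L (int u) \<ge> real L / (pi * (real u + 1/2))" and "csc_half L (int u) > 0"
proof -
  let ?a = "pi * (real u + 1/2) / real L"
  have "(real u + 1/2) / real L < 1" using assms by simp
  then have a: "0 < ?a" "?a < pi"
    using assms mult_strict_left_mono[of "(real u + 1/2) / real L" 1 pi] by (auto intro: divide_pos_pos mult_pos_pos add_nonneg_pos)
  then have s: "0 < sin ?a" by (rule sin_gt_zero)
  then show "csc_half L (int u) > 0" by (simp add: csc_half_def)
  have "1 / ?a \<le> 1 / sin ?a" using a s sin_x_le_x[of ?a] by (intro divide_left_mono mult_pos_pos) auto
  then show "csc_half L (int u) \<ge> real L / (pi * (real u + 1/2))" by (simp add: csc_half_def)
qed

lemma sum_inverse_odd_squares: "(\<Sum>u<n. 1 / (2 * real u + 1)\<^sup>2) \<le> 2 - 1 / (real n + 1)"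
proof (induction n)
  case (Suc n)
  show ?case
  proof (cases "n = 0")
    case False
    then have n: "real n \<ge> 1" by simp
    have "(real n + 1) * (real n + 2) \<le> (2 * real n + 1)\<^sup>2"
    proof -
      have "(2 * real n + 1)\<^sup>2 - (real n + 1) * (real n + 2) = 3 * (real n * real n) + real n - 1"
        by (simp add: power2_eq_square algebra_simps)
      also have "\<dots> \<ge> 0" using n mult_nonneg_nonneg[of "real n" "real n"] by linarith
      finally show ?thesis by simp
    qed
    then have "1 / (2 * real n + 1)\<^sup>2 \<le> 1 / ((real n + 1) * (real n + 2))"
      by (intro divide_left_mono) auto
    also have "\<dots> = 1 / (real n + 1) - 1 / (real n + 2)" by (simp add: field_simps)
    finally show ?thesis using Suc by (simp add: algebra_simps)
  qed simp
qed simp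

text \<open>
  From \<open>y * cos y \<le> sin y\<close> at \<open>y = x / 2\<close>: \<open>sin x = 2 * sin y * cos y \<ge> 2 * y * (cos y)\<^sup>2 \<ge> y\<close>,
  the last step because \<open>y \<le> pi / 4\<close>.
\<close>

lemma sin_ge_half:
  fixes x :: real
  assumes "0 \<le> x" "x \<le> pi / 2" shows "x / 2 \<le> sin x"
proof -
  define y where "y = x / 2"
  have y: "0 \<le> y" "y \<le> pi / 4" using assms by (auto simp: y_def)
  have "sin 0 - 0 * cos 0 \<le> sin y - y * cos y"
  proof (rule DERIV_nonneg_imp_nondecreasing[OF y(1)])
    fix z assume z: "0 \<le> z" "z \<le> y"
    have "((\<lambda>z. sin z - z * cos z) has_real_derivative z * sin z) (at z)"
      by (auto intro!: derivative_eq_intros)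
    moreover have "z * sin z \<ge> 0" using z y pi_gt_zero by (intro mult_nonneg_nonneg sin_ge_zero) auto
    ultimately show "\<exists>d. ((\<lambda>z. sin z - z * cos z) has_real_derivative d) (at z) \<and> 0 \<le> d" by blast
  qed
  then have sy: "y * cos y \<le> sin y" by simp
  have "cos (pi / 4) \<le> cos y" using y by (intro cos_monotone_0_pi_le) auto
  then have cy: "sqrt 2 / 2 \<le> cos y" by (simp add: cos_45)
  have "(sqrt 2 / 2)\<^sup>2 \<le> (cos y)\<^sup>2" using cy by (intro power_mono) auto
  then have "1 / 2 \<le> (cos y)\<^sup>2" by (simp add: power_divide)
  then have "y * (1/2) \<le> y * (cos y)\<^sup>2" using y by (intro mult_left_mono) auto
  also have "\<dots> = (y * cos y) * cos y" by (simp add: power2_eq_square)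
  also have "\<dots> \<le> sin y * cos y" using sy order_trans[OF _ cy, of 0] by (intro mult_right_mono) auto
  finally have "y \<le> sin (2 * y)" by (simp add: sin_double)
  then show ?thesis by (simp add: y_def)
qed

lemma csc_half_upper:
  assumes "2 * u < L" shows "(csc_half L (int u))\<^sup>2 \<le> 2 * (real L)\<^sup>2 * (1 / (2 * real u + 1)\<^sup>2)"
proof -
  let ?a = "pi * (real u + 1/2) / real L"
  have L: "L > 0" using assms by simp
  have "real (2 * u + 1) \<le> real L" using assms by (intro of_nat_mono) simp
  then have "2 * (real u + 1/2) \<le> real L" by simp
  then have "(real u + 1/2) / real L \<le> 1 / 2" using L by (simp add: field_simps)
  then have a: "0 < ?a" "?a \<le> pi / 2"
    using L mult_left_mono[of "(real u + 1/2) / real L" "1/2" pi]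
    by (auto intro: divide_pos_pos mult_pos_pos add_nonneg_pos)
  have "3 * (2 * real u + 1) / (4 * real L) \<le> ?a / 2"
    using mult_right_mono[of 3 pi "(2 * real u + 1) / (4 * real L)"] pi_gt3 by (simp add: field_simps)
  also have "\<dots> \<le> sin ?a" using a by (intro sin_ge_half) auto
  finally have "1 / (sin ?a)\<^sup>2 \<le> 1 / (3 * (2 * real u + 1) / (4 * real L))\<^sup>2"
    using L sin_gt_zero[of ?a] a pi_gt_zero
    by (intro divide_left_mono power_mono mult_pos_pos zero_less_power) auto
  also have "\<dots> = 16 / 9 * ((real L)\<^sup>2 * (1 / (2 * real u + 1)\<^sup>2))"
  proof -
    have "(3 * (2 * real u + 1) / (4 * real L))\<^sup>2 = 9 * (2 * real u + 1)\<^sup>2 / (16 * (real L)\<^sup>2)"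
      unfolding power_divide power_mult_distrib by simp
    then show ?thesis by simp
  qed
  also have "\<dots> \<le> 2 * ((real L)\<^sup>2 * (1 / (2 * real u + 1)\<^sup>2))"
    by (intro mult_right_mono) auto
  finally show ?thesis by (simp add: csc_half_def power_divide)
qed

text \<open>
  The summands at \<open>t\<close> and \<open>L - 1 - t\<close> agree, and for the smaller of the two the sine is
  comparable to its argument, so that the sum is bounded by \<open>L\<^sup>2\<close> times a convergent series.
\<close>

lemma csc_energy_le: "csc_energy L \<le> 8 * (real L)\<^sup>2"
proof -
  let ?h = "\<lambda>u. 2 * (real L)\<^sup>2 * (1 / (2 * real u + 1)\<^sup>2)"
  have h0: "?h u \<ge> 0" for u by simp
  have "csc_energy L \<le> (\<Sum>t<L. ?h t + ?h (L - Suc t))"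
    unfolding csc_energy_def
  proof (intro sum_mono)
    fix t assume t: "t \<in> {..<L}"
    show "(csc_half L (int t))\<^sup>2 \<le> ?h t + ?h (L - Suc t)"
    proof (cases "2 * t < L")
      case True
      then show ?thesis using csc_half_upper[OF True] h0[of "L - Suc t"] by linarith
    next
      case False
      then have "2 * (L - Suc t) < L" using t by auto
      moreover have "csc_half L (int (L - Suc t)) = csc_half L (int t)"
      proof -
        have "int (L - Suc t) = int L - 1 - int t" using t by auto
        then show ?thesis using csc_half_reflect[of L "int t"] t by auto
      qed
      ultimately show ?thesis using csc_half_upper[of "L - Suc t" L] h0[of t] by (metis add_increasing)
    qed
  qed
  also have "\<dots> = 4 * (real L)\<^sup>2 * (\<Sum>t<L. 1 / (2 * real t + 1)\<^sup>2)"
  proof -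
    have "(\<Sum>t<L. ?h (L - Suc t)) = (\<Sum>t<L. ?h t)" by (rule sum.nat_diff_reindex)
    then have "(\<Sum>t<L. ?h t + ?h (L - Suc t)) = 2 * (\<Sum>t<L. ?h t)" by (simp only: sum.distrib mult_2)
    also have "(\<Sum>t<L. ?h t) = 2 * (real L)\<^sup>2 * (\<Sum>t<L. 1 / (2 * real t + 1)\<^sup>2)"
      by (rule sum_distrib_left[symmetric])
    finally show ?thesis by simp
  qed
  also have "\<dots> \<le> 4 * (real L)\<^sup>2 * 2"
    using sum_inverse_odd_squares[of L] by (intro mult_left_mono) (auto intro: order_trans)
  finally show ?thesis by simp
qed

lemma csc_energy_pos: "L > 0 \<Longrightarrow> csc_energy L > 0"
  unfolding csc_energy_def
  by (intro sum_pos) (auto dest: csc_half_bounds(2) simp: zero_less_power2 less_imp_neq[symmetric])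

lemma abs_csc_half_le:
  assumes "i < L" "t < L" shows "\<bar>csc_half L (int i - int t)\<bar> \<le> sqrt (csc_energy L)"
proof -
  have "(csc_half L (int i - int t))\<^sup>2 \<le> (\<Sum>t<L. (csc_half L (int i - int t))\<^sup>2)"
    using assms by (intro member_le_sum) auto
  then show ?thesis using assms by (simp add: sum_csc_half_square real_le_rsqrt)
qed

text \<open>
  To the right of the diagonal all entries of a column are positive and at least those of the
  harmonic series.
\<close>

lemma sum_csc_half_tail_ge:
  assumes "2 * t < L"
  shows "(\<Sum>i\<in>{t..<L}. csc_half L (int i - int t)) \<ge> real L / pi * ln (real L / 2)"
proof -
  have L: "L > 0" using assms by simp
  have "real L / pi * ln (real L / 2) \<le> real L / pi * ln (real (Suc (L - t)))"
    using assms L by (intro mult_left_mono ln_mono) auto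
  also have "\<dots> \<le> real L / pi * harm (L - t)"
    using ln_le_harm[of "L - t"] by (intro mult_left_mono) (auto simp: add.commute)
  also have "\<dots> = (\<Sum>u<L - t. real L / pi * (1 / real (Suc u)))"
    by (simp add: harm_altdef sum_distrib_left inverse_eq_divide)
  also have "\<dots> \<le> (\<Sum>u<L - t. csc_half L (int u))"
  proof (intro sum_mono)
    fix u assume u: "u \<in> {..<L - t}"
    have "real L / pi * (1 / real (Suc u)) \<le> real L / (pi * (real u + 1/2))"
    proof -
      have "real L / (pi * real (Suc u)) \<le> real L / (pi * (real u + 1/2))"
        using L by (intro divide_left_mono mult_left_mono mult_pos_pos) auto
      then show ?thesis by simp
    qed
    also have "\<dots> \<le> csc_half L (int u)" using u by (intro csc_half_bounds) auto
    finally show "real L / pi * (1 / real (Suc u)) \<le> csc_half L (int u)" .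
  qed
  also have "\<dots> = (\<Sum>i\<in>{t..<L}. csc_half L (int i - int t))"
    by (rule sum.reindex_bij_witness[of _ "\<lambda>i. i - t" "\<lambda>u. u + t"]) auto
  finally show ?thesis .
qed

text \<open>
  The Walsh functions in Paley form: \<open>walsh k r y\<close> is \<open>-1\<close> to the number of positions among
  the lowest \<open>k\<close> at which both \<open>r\<close> and \<open>y\<close> have the binary digit \<open>1\<close>.
\<close>

fun walsh :: "nat \<Rightarrow> nat \<Rightarrow> nat \<Rightarrow> real" where
  "walsh 0 r y = 1"
| "walsh (Suc k) r y = (if odd r \<and> odd y then - 1 else 1) * walsh k (r div 2) (y div 2)"

lemma walsh_commute: "walsh k r y = walsh k y r"
  by (induction k arbitrary: r y) auto

lemma abs_walsh [simp]: "\<bar>walsh k r y\<bar> = 1"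
  by (induction k arbitrary: r y) (auto simp: abs_mult)

lemma walsh_zero [simp]: "walsh k r 0 = 1" "walsh k 0 r = 1"
  by (induction k arbitrary: r) auto

lemma sum_even_odd: "(\<Sum>y<2 * n. f y) = (\<Sum>y<n. f (2 * y) + f (2 * y + 1))" for f :: "nat \<Rightarrow> real"
  by (induction n) (auto simp: algebra_simps)

lemma sum_walsh_mult:
  assumes "r < 2 ^ k" "r' < 2 ^ k"
  shows "(\<Sum>y<2 ^ k. walsh k r y * walsh k r' y) = (if r = r' then 2 ^ k else 0)"
  using assms
proof (induction k arbitrary: r r')
  case (Suc k)
  let ?s = "(if odd r then - 1 else 1) * (if odd r' then - 1 else 1) :: real"
  have "(\<Sum>y<2 ^ Suc k. walsh (Suc k) r y * walsh (Suc k) r' y)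
      = (\<Sum>y<2 ^ k. (1 + ?s) * (walsh k (r div 2) y * walsh k (r' div 2) y))"
    unfolding power_Suc sum_even_odd by (intro sum.cong refl) (auto simp: algebra_simps)
  also have "\<dots> = (1 + ?s) * (if r div 2 = r' div 2 then 2 ^ k else 0)"
    using Suc.prems by (subst Suc.IH[symmetric]) (auto simp: sum_distrib_left)
  also have "\<dots> = (if r = r' then 2 ^ Suc k else 0)"
    by (auto elim!: evenE oddE)
  finally show ?case .
qed simp

lemma sum_walsh_index:
  assumes "y < 2 ^ k" shows "(\<Sum>r<2 ^ k. walsh k r y) = (if y = 0 then 2 ^ k else 0)"
  using sum_walsh_mult[of y k 0] assms by (simp add: walsh_commute)

section \<open>Independent digits on the unit interval\<close>

abbreviation unit_measure :: "real measure" where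
  "unit_measure \<equiv> restrict_space lborel {0..1}"

lemma finite_unit_measure: "finite_measure unit_measure"
  by (rule finite_measureI) (simp add: emeasure_restrict_space space_restrict_space)

lemma measure_unit_measure: "measure unit_measure (space unit_measure) = 1"
  by (simp add: measure_restrict_space space_restrict_space)

definition cell :: "nat \<Rightarrow> real \<Rightarrow> nat" where
  "cell Q x = nat \<lfloor>real Q * x\<rfloor>"

lemma cell_measurable [measurable]: "cell Q \<in> borel \<rightarrow>\<^sub>M count_space UNIV"
  unfolding cell_def by measurable

lemma cell_div: "cell (P * Q) x div Q = cell P x" if "Q > 0"
proof -
  have "\<lfloor>real (P * Q) * x\<rfloor> div int Q = \<lfloor>real (P * Q) * x / real_of_int (int Q)\<rfloor>"
    by (rule floor_divide_real_eq_div[symmetric]) simp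
  also have "real (P * Q) * x / real_of_int (int Q) = real P * x" using that by simp
  finally show ?thesis unfolding cell_def
    by (metis nat_div_distrib' nat_int of_nat_0_le_iff)
qed

text \<open>
  The number \<open>cell Q x\<close> says which of the \<open>Q\<close> equal parts of the unit interval contains \<open>x\<close>; only
  at \<open>x = 1\<close>, a null set, does it leave \<open>{0..<Q}\<close>.
\<close>

lemma has_integral_cell:
  fixes \<phi> :: "nat \<Rightarrow> real"
  assumes "Q > 0"
  shows "has_bochner_integral unit_measure (\<lambda>x. \<phi> (cell Q x)) ((\<Sum>w<Q. \<phi> w) / real Q)"
proof -
  let ?I = "\<lambda>w. {real w / real Q..<(real w + 1) / real Q}"
  have meas: "(\<lambda>x. \<Sum>w<Q. \<phi> w * indicator (?I w) x) \<in> borel_measurable lborel"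
      "(\<lambda>x. indicator {0..1} x *\<^sub>R \<phi> (cell Q x)) \<in> borel_measurable lborel"
    by measurable
  have "has_bochner_integral lborel (\<lambda>x. \<Sum>w<Q. \<phi> w * indicator (?I w) x) (\<Sum>w<Q. \<phi> w * (1 / real Q))"
  proof (intro has_bochner_integral_sum has_bochner_integral_mult_right)
    fix w
    have "has_bochner_integral lborel (indicator (?I w) :: real \<Rightarrow> real) (measure lborel (?I w))"
      using divide_right_mono[of "real w" "real w + 1" "real Q"]
      by (intro has_bochner_integral_real_indicator) (auto simp: emeasure_lborel_Ico)
    also have "measure lborel (?I w) = 1 / real Q"
      using assms by (simp add: field_simps)
    finally show "has_bochner_integral lborel (indicator (?I w) :: real \<Rightarrow> real) (1 / real Q)" .
  qed
  moreover have ae: "AE x in lborel. (\<Sum>w<Q. \<phi> w * indicator (?I w) x) = indicator {0..1} x *\<^sub>R \<phi> (cell Q x)"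
    using AE_lborel_singleton[of 1]
  proof eventually_elim
    fix x :: real assume "x \<noteq> 1"
    have ind: "indicator (?I w) x = (if 0 \<le> x \<and> cell Q x = w then 1 else 0 :: real)" for w
    proof -
      have "x \<in> ?I w \<longleftrightarrow> real w \<le> real Q * x \<and> real Q * x < real w + 1"
        using assms by (auto simp: field_simps)
      also have "\<dots> \<longleftrightarrow> \<lfloor>real Q * x\<rfloor> = int w" by (auto simp: floor_eq_iff)
      also have "\<dots> \<longleftrightarrow> 0 \<le> x \<and> cell Q x = w"
      proof
        assume floor: "\<lfloor>real Q * x\<rfloor> = int w"
        then have "0 \<le> real Q * x" by (metis of_nat_0_le_iff zero_le_floor)
        then show "0 \<le> x \<and> cell Q x = w"
          using assms floor by (simp add: cell_def zero_le_mult_iff)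
      next
        assume "0 \<le> x \<and> cell Q x = w"
        then show "\<lfloor>real Q * x\<rfloor> = int w"
          by (metis cell_def int_nat_eq mult_nonneg_nonneg of_nat_0_le_iff zero_le_floor)
      qed
      finally show ?thesis by (simp add: indicator_def)
    qed
    have lt: "cell Q x < Q \<longleftrightarrow> x < 1" if "0 \<le> x"
    proof -
      have "real Q * x < real Q \<longleftrightarrow> x < 1" using assms by simp
      then show ?thesis using that assms by (simp add: cell_def nat_less_iff floor_less_iff)
    qed
    have "(\<Sum>w<Q. \<phi> w * indicator (?I w) x) = (if 0 \<le> x \<and> cell Q x < Q then \<phi> (cell Q x) else 0)"
    proof (cases "0 \<le> x \<and> cell Q x < Q")
      case True
      then have "(\<Sum>w<Q. \<phi> w * indicator (?I w) x) = (\<Sum>w\<in>{cell Q x}. \<phi> w * indicator (?I w) x)"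
        by (intro sum.mono_neutral_right) (auto simp: ind)
      then show ?thesis using True ind by simp
    next
      case False
      then have "(\<Sum>w<Q. \<phi> w * indicator (?I w) x) = 0"
        by (intro sum.neutral) (auto simp: ind)
      then show ?thesis by (simp only: False if_False)
    qed
    also have "\<dots> = indicator {0..1} x *\<^sub>R \<phi> (cell Q x)"
      using lt \<open>x \<noteq> 1\<close> by (auto simp: indicator_def)
    finally show "(\<Sum>w<Q. \<phi> w * indicator (?I w) x) = indicator {0..1} x *\<^sub>R \<phi> (cell Q x)" .
  qed
  ultimately have "has_bochner_integral lborel (\<lambda>x. indicator {0..1} x *\<^sub>R \<phi> (cell Q x)) (\<Sum>w<Q. \<phi> w * (1 / real Q))"
    using has_bochner_integral_cong_AE[OF meas ae] by blast
  then have "has_bochner_integral unit_measure (\<lambda>x. \<phi> (cell Q x)) (\<Sum>w<Q. \<phi> w * (1 / real Q))"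
    by (simp add: has_bochner_integral_restrict_space)
  then show ?thesis by (simp flip: sum_divide_distrib)
qed

lemma combine_lt: "a < A \<Longrightarrow> b < B \<Longrightarrow> a * B + b < A * B" for a b A B :: nat
proof -
  assume "a < A" "b < B"
  then have "a * B + b < Suc a * B" by simp
  also have "\<dots> \<le> A * B" using \<open>a < A\<close> by (intro mult_le_mono1) simp
  finally show ?thesis .
qed

lemma sum_div_mod:
  fixes f :: "nat \<Rightarrow> nat \<Rightarrow> real"
  assumes "B > 0"
  shows "(\<Sum>w<A * B. f (w div B) (w mod B)) = (\<Sum>a<A. \<Sum>b<B. f a b)"
proof -
  have "(\<Sum>a<A. \<Sum>b<B. f a b) = (\<Sum>(a, b)\<in>{..<A} \<times> {..<B}. f a b)"
    by (simp add: sum.cartesian_product)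
  also have "\<dots> = (\<Sum>w<A * B. f (w div B) (w mod B))"
    by (rule sum.reindex_bij_witness[of _ "\<lambda>w. (w div B, w mod B)" "\<lambda>(a, b). a * B + b"])
       (use assms in \<open>auto simp: less_mult_imp_div_less mult.commute intro: combine_lt\<close>)
  finally show ?thesis by simp
qed

text \<open>
  The digit \<open>cell (P * Q) x mod Q\<close> is uniformly distributed on \<open>{0..<Q}\<close> and independent of the
  coarser position \<open>cell P x\<close>.
\<close>

lemma integral_cell_digit:
  fixes \<phi> \<psi> :: "nat \<Rightarrow> real"
  assumes "P > 0" "Q > 0"
  shows "(\<integral>x. \<phi> (cell P x) * \<psi> (cell (P * Q) x mod Q) \<partial>unit_measure)
    = (\<integral>x. \<phi> (cell P x) \<partial>unit_measure) * ((\<Sum>w<Q. \<psi> w) / real Q)"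
proof -
  have "(\<integral>x. \<phi> (cell P x) * \<psi> (cell (P * Q) x mod Q) \<partial>unit_measure)
      = (\<integral>x. (\<lambda>w. \<phi> (w div Q) * \<psi> (w mod Q)) (cell (P * Q) x) \<partial>unit_measure)"
    using cell_div[of Q P] assms by simp
  also have "\<dots> = (\<Sum>w<P * Q. \<phi> (w div Q) * \<psi> (w mod Q)) / real (P * Q)"
    using has_integral_cell[of "P * Q" "\<lambda>w. \<phi> (w div Q) * \<psi> (w mod Q)"] assms
    by (intro has_bochner_integral_integral_eq) simp
  also have "\<dots> = ((\<Sum>a<P. \<phi> a) * (\<Sum>b<Q. \<psi> b)) / real (P * Q)"
    using assms by (subst sum_div_mod) (auto simp: sum_product)
  also have "\<dots> = (\<integral>x. \<phi> (cell P x) \<partial>unit_measure) * ((\<Sum>w<Q. \<psi> w) / real Q)"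
    using has_integral_cell[OF assms(1), of \<phi>] by (simp add: has_bochner_integral_integral_eq)
  finally show ?thesis .
qed

text \<open>
  Finite orthonormal systems on the uniform probability spaces \<open>{0..<Q j}\<close> are made independent and
  concatenated into one sequence of functions on the unit interval. The spaces are read off from
  the digits of a point in the mixed radix expansion with bases \<open>Q 0\<close>, \<open>Q 1\<close>, and so on.
\<close>

locale digit_blocks =
  fixes len Q :: "nat \<Rightarrow> nat" and X :: "nat \<Rightarrow> nat \<Rightarrow> nat \<Rightarrow> real"
  assumes len_pos: "\<And>j. 0 < len j" and Q_pos: "\<And>j. 0 < Q j"
    and X_bound: "\<And>j n w. n < len j \<Longrightarrow> \<bar>X j n w\<bar> \<le> 2"
    and X_mean: "\<And>j n. n < len j \<Longrightarrow> (\<Sum>w<Q j. X j n w) = 0"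
    and X_orthonormal: "\<And>j n n'. n < len j \<Longrightarrow> n' < len j \<Longrightarrow>
      (\<Sum>w<Q j. X j n w * X j n' w) = (if n = n' then real (Q j) else 0)"
begin

definition radix :: "nat \<Rightarrow> nat" where "radix j = (\<Prod>i<j. Q i)"

definition digit :: "nat \<Rightarrow> real \<Rightarrow> nat" where "digit j x = cell (radix (Suc j)) x mod Q j"

definition start :: "nat \<Rightarrow> nat" where "start j = (\<Sum>i<j. len i)"

definition block_of :: "nat \<Rightarrow> nat" where "block_of n = (LEAST j. n < start (Suc j))"

definition joined :: "nat \<Rightarrow> real \<Rightarrow> real" where
  "joined n x = X (block_of n) (n - start (block_of n)) (digit (block_of n) x)"

lemma radix_pos: "radix j > 0" unfolding radix_def using Q_pos by (simp add: prod_pos)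

lemma radix_Suc: "radix (Suc j) = radix j * Q j" by (simp add: radix_def)

lemma start_Suc: "start (Suc j) = start j + len j" by (simp add: start_def)

lemma start_mono: "i \<le> j \<Longrightarrow> start i \<le> start j"
  unfolding start_def by (intro sum_mono2) auto

lemma start_ge: "j \<le> start j"
proof (induction j)
  case (Suc j)
  then show ?case using len_pos[of j] by (simp add: start_Suc)
qed simp

lemma block_of: "start (block_of n) \<le> n" "n < start (block_of n) + len (block_of n)"
proof -
  have "n < start (Suc n)" using start_ge[of "Suc n"] by simp
  then have "n < start (Suc (block_of n))" unfolding block_of_def by (rule LeastI)
  then show "n < start (block_of n) + len (block_of n)" by (simp add: start_Suc)
  show "start (block_of n) \<le> n"
  proof (cases "block_of n")
    case (Suc j)
    then have "j < (LEAST j. n < start (Suc j))" by (simp add: block_of_def)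
    from not_less_Least[OF this] show ?thesis using Suc by simp
  qed (simp add: start_def)
qed

lemma block_of_eq: "start j \<le> n \<Longrightarrow> n < start j + len j \<Longrightarrow> block_of n = j"
  unfolding block_of_def
proof (rule Least_equality)
  fix i assume "start j \<le> n" "n < start (Suc i)"
  then show "j \<le> i" using start_mono[of "Suc i" j] by (meson leD le_trans not_less_eq_eq)
qed (simp add: start_Suc)

lemma joined_start: "n < len j \<Longrightarrow> joined (start j + n) x = X j n (digit j x)"
  using block_of_eq[of j "start j + n"] by (simp add: joined_def)

lemma abs_joined_le: "\<bar>joined n x\<bar> \<le> 2"
  unfolding joined_def using block_of[of n] by (intro X_bound) linarith

lemma digit_measurable [measurable]: "digit j \<in> unit_measure \<rightarrow>\<^sub>M count_space UNIV"
proof -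
  have "cell (radix (Suc j)) \<in> unit_measure \<rightarrow>\<^sub>M count_space UNIV"
    by (rule measurable_restrict_space1) simp
  then show ?thesis unfolding digit_def by measurable
qed

lemma digit_comp_measurable [measurable]: "(\<lambda>x. \<phi> (digit j x)) \<in> borel_measurable unit_measure"
  for \<phi> :: "nat \<Rightarrow> real"
  by (rule measurable_compose[OF digit_measurable]) simp

lemma joined_measurable [measurable]: "joined n \<in> borel_measurable unit_measure"
proof -
  have "(\<lambda>x. joined n x) \<in> borel_measurable unit_measure"
    unfolding joined_def by (rule digit_comp_measurable)
  then show ?thesis by simp
qed

text \<open>
  The position \<open>c = cell (radix j) x\<close> determines every earlier digit of \<open>x\<close>. Recomputing them from \<open>c\<close> turns
  functions of the earlier digits into functions of one cell number, to which independence applies.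
\<close>

definition past :: "nat \<Rightarrow> nat \<Rightarrow> nat \<Rightarrow> nat" where
  "past i j c = c div (\<Prod>l\<in>{Suc i..<j}. Q l) mod Q i"

lemma digit_past:
  assumes "i < j" shows "digit i x = past i j (cell (radix j) x)"
proof -
  have un: "{..<j} = {..<Suc i} \<union> {Suc i..<j}" using assms by auto
  have "radix j = radix (Suc i) * (\<Prod>l\<in>{Suc i..<j}. Q l)"
    unfolding radix_def un by (rule prod.union_disjoint) auto
  moreover have "(\<Prod>l\<in>{Suc i..<j}. Q l) > 0" by (intro prod_pos Q_pos)
  ultimately have "cell (radix j) x div (\<Prod>l\<in>{Suc i..<j}. Q l) = cell (radix (Suc i)) x"
    by (simp only: cell_div)
  then show ?thesis unfolding digit_def past_def by (simp only:)
qed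

lemma integral_past_digit:
  "(\<integral>x. \<phi> (cell (radix j) x) * \<psi> (digit j x) \<partial>unit_measure)
    = (\<integral>x. \<phi> (cell (radix j) x) \<partial>unit_measure) * ((\<Sum>w<Q j. \<psi> w) / real (Q j))"
  unfolding digit_def radix_Suc by (rule integral_cell_digit[OF radix_pos Q_pos, where \<phi> = \<phi> and \<psi> = \<psi>])

lemma integral_digit: "(\<integral>x. \<psi> (digit j x) \<partial>unit_measure) = (\<Sum>w<Q j. \<psi> w) / real (Q j)"
  using integral_past_digit[of "\<lambda>_. 1" j \<psi>] measure_unit_measure by simp

lemma integral_joined: "(\<integral>x. joined n x \<partial>unit_measure) = 0"
proof -
  have "n - start (block_of n) < len (block_of n)" using block_of[of n] by linarith
  then show ?thesis unfolding joined_def by (simp add: integral_digit X_mean)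
qed

lemma integral_joined_mult_less:
  assumes "n < n'" shows "(\<integral>x. joined n x * joined n' x \<partial>unit_measure) = 0"
proof -
  have n: "n - start (block_of n) < len (block_of n)" and n': "n' - start (block_of n') < len (block_of n')"
    using block_of[of n] block_of[of n'] by linarith+
  show ?thesis
  proof (cases "block_of n = block_of n'")
    case True
    have "(\<integral>x. joined n x * joined n' x \<partial>unit_measure)
        = (\<integral>x. (\<lambda>w. X (block_of n) (n - start (block_of n)) w * X (block_of n) (n' - start (block_of n)) w) (digit (block_of n) x) \<partial>unit_measure)"
      unfolding joined_def True by simp
    also have "\<dots> = 0"
      using X_orthonormal[of "n - start (block_of n)" "block_of n" "n' - start (block_of n)"] n n' True assms block_of(1)[of n]
      by (subst integral_digit) auto
    finally show ?thesis .
  next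
    case False
    have "block_of n < block_of n'"
    proof (rule ccontr)
      assume "\<not> block_of n < block_of n'"
      then have "Suc (block_of n') \<le> block_of n" using False by simp
      then have "start (Suc (block_of n')) \<le> n" using start_mono block_of(1)[of n] le_trans by blast
      then show False using block_of(2)[of n'] assms by (simp add: start_Suc)
    qed
    define \<phi> where "\<phi> c = X (block_of n) (n - start (block_of n)) (past (block_of n) (block_of n') c)" for c
    have "(\<integral>x. joined n x * joined n' x \<partial>unit_measure)
        = (\<integral>x. \<phi> (cell (radix (block_of n')) x) * X (block_of n') (n' - start (block_of n')) (digit (block_of n') x) \<partial>unit_measure)"
      unfolding joined_def \<phi>_def by (simp only: digit_past[OF \<open>block_of n < block_of n'\<close>])
    also have "\<dots> = (\<integral>x. \<phi> (cell (radix (block_of n')) x) \<partial>unit_measure)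
        * ((\<Sum>w<Q (block_of n'). X (block_of n') (n' - start (block_of n')) w) / real (Q (block_of n')))"
      by (rule integral_past_digit)
    also have "\<dots> = 0" by (simp add: X_mean n')
    finally show ?thesis .
  qed
qed

lemma integral_joined_mult: "(\<integral>x. joined n x * joined n' x \<partial>unit_measure) = (if n = n' then 1 else 0)"
proof (cases n n' rule: linorder_cases)
  case less
  then show ?thesis by (simp add: integral_joined_mult_less)
next
  case equal
  have n: "n - start (block_of n) < len (block_of n)" using block_of[of n] by linarith
  have "(\<integral>x. joined n x * joined n x \<partial>unit_measure)
      = (\<integral>x. (\<lambda>w. X (block_of n) (n - start (block_of n)) w * X (block_of n) (n - start (block_of n)) w) (digit (block_of n) x) \<partial>unit_measure)"
    unfolding joined_def by simp
  also have "\<dots> = 1" using X_orthonormal[OF n n] Q_pos[of "block_of n"] by (subst integral_digit) simp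
  finally show ?thesis using equal by simp
next
  case greater
  then show ?thesis using integral_joined_mult_less[of n' n] by (simp add: mult.commute)
qed

lemma integrable_joined_mult: "integrable unit_measure (\<lambda>x. joined n x * joined n' x)"
proof (rule finite_measure.integrable_const_bound[OF finite_unit_measure])
  have "\<bar>joined n x * joined n' x\<bar> \<le> 2 * 2" for x
    unfolding abs_mult by (intro mult_mono abs_joined_le) auto
  then show "AE x in unit_measure. norm (joined n x * joined n' x) \<le> 4" by simp
qed measurable

lemma integral_sum_joined_square:
  assumes "finite S"
  shows "integrable unit_measure (\<lambda>x. (\<Sum>n\<in>S. joined n x)\<^sup>2)"
    and "(\<integral>x. (\<Sum>n\<in>S. joined n x)\<^sup>2 \<partial>unit_measure) = real (card S)"
proof -
  have eq: "(\<Sum>n\<in>S. joined n x)\<^sup>2 = (\<Sum>n\<in>S. \<Sum>n'\<in>S. joined n x * joined n' x)" for x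
    by (simp add: power2_eq_square sum_product)
  show "integrable unit_measure (\<lambda>x. (\<Sum>n\<in>S. joined n x)\<^sup>2)"
    unfolding eq by (intro Bochner_Integration.integrable_sum integrable_joined_mult)
  show "(\<integral>x. (\<Sum>n\<in>S. joined n x)\<^sup>2 \<partial>unit_measure) = real (card S)"
    unfolding eq using assms
    by (simp add: Bochner_Integration.integral_sum Bochner_Integration.integrable_sum integrable_joined_mult integral_joined_mult)
qed

lemma integral_prod_digits:
  "(\<integral>x. (\<Prod>j\<in>{m..<m + n}. \<psi> j (digit j x)) \<partial>unit_measure)
    = (\<Prod>j\<in>{m..<m + n}. (\<Sum>w<Q j. \<psi> j w) / real (Q j))"
proof (induction n)
  case 0
  then show ?case using measure_unit_measure by simp
next
  case (Suc n)
  have split: "(\<Prod>j\<in>{m..<m + Suc n}. h j) = (\<Prod>j\<in>{m..<m + n}. h j) * h (m + n)" for h :: "nat \<Rightarrow> real"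
    by simp
  define \<Psi> where "\<Psi> c = (\<Prod>j\<in>{m..<m + n}. \<psi> j (past j (m + n) c))" for c
  have past: "(\<Prod>j\<in>{m..<m + n}. \<psi> j (digit j x)) = \<Psi> (cell (radix (m + n)) x)" for x
    unfolding \<Psi>_def by (intro prod.cong refl arg_cong[where f = "\<psi> _"] digit_past) simp
  have "(\<integral>x. (\<Prod>j\<in>{m..<m + Suc n}. \<psi> j (digit j x)) \<partial>unit_measure)
      = (\<integral>x. \<Psi> (cell (radix (m + n)) x) * \<psi> (m + n) (digit (m + n) x) \<partial>unit_measure)"
    by (simp only: split past)
  also have "\<dots> = (\<integral>x. \<Psi> (cell (radix (m + n)) x) \<partial>unit_measure)
      * ((\<Sum>w<Q (m + n). \<psi> (m + n) w) / real (Q (m + n)))"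
    by (rule integral_past_digit)
  also have "(\<integral>x. \<Psi> (cell (radix (m + n)) x) \<partial>unit_measure)
      = (\<Prod>j\<in>{m..<m + n}. (\<Sum>w<Q j. \<psi> j w) / real (Q j))"
    by (simp only: Suc.IH flip: past)
  finally show ?case by (simp only: split)
qed

text \<open>
  This is the second Borel-Cantelli lemma: by independence the probability that no digit from a given
  stretch lies in its set is at most \<open>exp\<close> of minus the sum of the probabilities.
\<close>

theorem AE_frequently_digit:
  assumes not_summable: "\<not> summable (\<lambda>j. real (card {w. w < Q j \<and> w \<in> G j}) / real (Q j))"
  shows "AE x in unit_measure. \<exists>\<^sub>F j in sequentially. digit j x \<in> G j"
proof -
  interpret finite_measure unit_measure by (rule finite_unit_measure)
  define p where "p j = real (card {w. w < Q j \<and> w \<in> G j}) / real (Q j)" for j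
  define A where "A m n = {x \<in> space unit_measure. \<forall>j\<in>{m..<m + n}. digit j x \<notin> G j}" for m n
  have A_sets [measurable]: "A m n \<in> sets unit_measure" for m n
    unfolding A_def by measurable
  have measure_A: "measure unit_measure (A m n) \<le> exp (- (\<Sum>j\<in>{m..<m + n}. p j))" for m n
  proof -
    define \<psi> where "\<psi> j w = (if w \<in> G j then 0 else 1 :: real)" for j w
    have "measure unit_measure (A m n) = (\<integral>x. indicator (A m n) x \<partial>unit_measure)"
    proof -
      have "A m n \<inter> {0..1} = A m n" by (auto simp: A_def space_restrict_space)
      then show ?thesis by simp
    qed
    also have "\<dots> = (\<integral>x. (\<Prod>j\<in>{m..<m + n}. \<psi> j (digit j x)) \<partial>unit_measure)"
      by (intro Bochner_Integration.integral_cong refl)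
         (auto simp: A_def \<psi>_def indicator_def prod_zero_iff)
    also have "\<dots> = (\<Prod>j\<in>{m..<m + n}. (\<Sum>w<Q j. \<psi> j w) / real (Q j))"
      by (rule integral_prod_digits)
    also have "\<dots> \<le> (\<Prod>j\<in>{m..<m + n}. exp (- p j))"
    proof (intro prod_mono conjI)
      fix j
      have "(\<Sum>w<Q j. \<psi> j w) = (\<Sum>w<Q j. 1 - indicator (G j) w)"
        by (intro sum.cong) (auto simp: \<psi>_def)
      also have "\<dots> = real (Q j) - (\<Sum>w<Q j. indicator (G j) w)"
        by (simp add: sum_subtractf)
      also have "(\<Sum>w<Q j. indicator (G j) w) = real (card ({..<Q j} \<inter> G j))"
        by (simp add: indicator_def sum.If_cases)
      also have "{..<Q j} \<inter> G j = {w. w < Q j \<and> w \<in> G j}" by auto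
      finally have "(\<Sum>w<Q j. \<psi> j w) / real (Q j) = 1 - p j"
        using Q_pos[of j] by (simp add: p_def diff_divide_distrib)
      then show "(\<Sum>w<Q j. \<psi> j w) / real (Q j) \<le> exp (- p j)"
        using exp_ge_add_one_self[of "- p j"] by simp
      show "0 \<le> (\<Sum>w<Q j. \<psi> j w) / real (Q j)"
        by (intro divide_nonneg_nonneg sum_nonneg) (auto simp: \<psi>_def)
    qed
    also have "\<dots> = exp (- (\<Sum>j\<in>{m..<m + n}. p j))"
      by (simp add: exp_sum sum_negf[symmetric])
    finally show ?thesis .
  qed
  have "AE x in unit_measure. \<exists>j\<ge>m. digit j x \<in> G j" for m
  proof -
    define B where "B = {x \<in> space unit_measure. \<forall>j\<ge>m. digit j x \<notin> G j}"
    have B [measurable]: "B \<in> sets unit_measure" unfolding B_def by measurable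
    have "measure unit_measure B = 0"
    proof (rule ccontr)
      assume "measure unit_measure B \<noteq> 0"
      then have pos: "measure unit_measure B > 0" by (simp add: zero_less_measure_iff)
      have "(\<Sum>j<n. p (j + m)) \<le> - ln (measure unit_measure B)" for n
      proof -
        have "measure unit_measure B \<le> measure unit_measure (A m n)"
          by (rule finite_measure_mono[OF _ A_sets]) (auto simp: A_def B_def)
        also note measure_A[of m n]
        finally have "ln (measure unit_measure B) \<le> - (\<Sum>j\<in>{m..<m + n}. p j)"
          using pos by (metis ln_exp ln_mono)
        also have "(\<Sum>j\<in>{m..<m + n}. p j) = (\<Sum>j<n. p (j + m))"
          by (rule sum.reindex_bij_witness[of _ "\<lambda>j. j + m" "\<lambda>j. j - m"]) auto
        finally show ?thesis by simp
      qed
      then have "summable (\<lambda>j. p (j + m))"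
        by (intro summableI_nonneg_bounded) (auto simp: p_def)
      then have "summable p" by (simp add: summable_iff_shift)
      then show False using not_summable by (simp add: p_def[abs_def])
    qed
    then have "emeasure unit_measure B = 0" by (simp add: emeasure_eq_measure)
    then show ?thesis
      by (rule AE_I[OF _ _ B, rotated]) (auto simp: B_def)
  qed
  then have "AE x in unit_measure. \<forall>m. \<exists>j\<ge>m. digit j x \<in> G j"
    by (simp add: AE_all_countable)
  then show ?thesis by (simp add: frequently_sequentially)
qed

end

section \<open>A bounded orthonormal block with large partial sums\<close>

text \<open>
  The coordinate \<open>p\<close> ranges over \<open>{0..<R}\<close> with \<open>R = L * M\<close>, so the support \<open>{0..<L}\<close> is an event of
  probability \<open>1 / M\<close> on which \<open>p\<close> is a column index. The squares sum to \<open>1\<close> over all \<open>p\<close>, so the mean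
  square is \<open>1 / R\<close>.
\<close>

definition spike :: "nat \<Rightarrow> nat \<Rightarrow> nat \<Rightarrow> real" where
  "spike L i p = (if p < L then csc_half L (int i - int p) / sqrt (csc_energy L) else 0)"

text \<open>
  Removing the point \<open>0\<close>, where all Walsh functions are \<open>1\<close>, changes the Gram matrix of the functions
  with indices below \<open>R = 2 ^ k\<close> from the identity \<open>I\<close> to \<open>I - J / R\<close>, \<open>J\<close> the all-one matrix, and
  makes their sum vanish identically.
\<close>

definition punctured_walsh :: "nat \<Rightarrow> nat \<Rightarrow> nat \<Rightarrow> real" where
  "punctured_walsh k r y = (if y = 0 then 0 else walsh k r y)"

text \<open>
  The function number \<open>r\<close> of group number \<open>i\<close>, with \<open>L = 2 ^ l\<close> and \<open>R = 2 ^ (l + m)\<close>. The spike does not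
  depend on \<open>r\<close> and contributes \<open>J / R\<close> to the Gram matrix of each group, which is exactly what the
  punctured Walsh functions lack. The signs in \<open>z\<close> are Walsh functions with distinct positive indices;
  they give mean zero, make the Walsh parts of different groups orthogonal, and remove all cross terms
  between the two parts.
\<close>

definition wave :: "nat \<Rightarrow> nat \<Rightarrow> nat \<Rightarrow> nat \<Rightarrow> nat \<Rightarrow> nat \<Rightarrow> nat \<Rightarrow> real" where
  "wave l m i r z p y = walsh (Suc l) (Suc (2 ^ l)) z * spike (2 ^ l) i p
     + walsh (Suc l) (Suc i) z * punctured_walsh (l + m) r y"

lemma abs_spike_le: "i < L \<Longrightarrow> \<bar>spike L i p\<bar> \<le> 1"
  using abs_csc_half_le[of i L p] csc_energy_pos[of L] by (auto simp: spike_def)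

lemma abs_wave_le:
  assumes "i < 2 ^ l" shows "\<bar>wave l m i r z p y\<bar> \<le> 2"
proof -
  have "\<bar>wave l m i r z p y\<bar> \<le> \<bar>spike (2 ^ l) i p\<bar> + \<bar>punctured_walsh (l + m) r y\<bar>"
    unfolding wave_def by (rule order_trans[OF abs_triangle_ineq]) (simp add: abs_mult)
  also have "\<dots> \<le> 1 + 1"
    using abs_spike_le[OF assms, of p] by (intro add_mono) (auto simp: punctured_walsh_def)
  finally show ?thesis by simp
qed

lemma sum_spike_mult:
  assumes "i < L" "i' < L" "L \<le> R"
  shows "(\<Sum>p<R. spike L i p * spike L i' p) = (if i = i' then 1 else 0)"
proof -
  have V: "csc_energy L > 0" using assms by (intro csc_energy_pos) simp
  have "(\<Sum>p<R. spike L i p * spike L i' p) = (\<Sum>p<L. spike L i p * spike L i' p)"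
    using assms by (intro sum.mono_neutral_right) (auto simp: spike_def)
  also have "\<dots> = (\<Sum>p<L. csc_half L (int i - int p) * csc_half L (int i' - int p) / csc_energy L)"
    using V by (intro sum.cong) (auto simp: spike_def)
  also have "\<dots> = (\<Sum>p<L. csc_half L (int i - int p) * csc_half L (int i' - int p)) / csc_energy L"
    by (rule sum_divide_distrib[symmetric])
  also have "\<dots> = (if i = i' then 1 else 0)"
    using V assms sum_csc_half_square[of L i] sum_csc_half_orthogonal[of i L i']
    by (auto simp: power2_eq_square)
  finally show ?thesis .
qed

lemma sum_punctured_walsh_mult:
  assumes "r < 2 ^ k" "r' < 2 ^ k"
  shows "(\<Sum>y<2 ^ k. punctured_walsh k r y * punctured_walsh k r' y) = (if r = r' then 2 ^ k else 0) - 1"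
proof -
  have "(\<Sum>y<2 ^ k. punctured_walsh k r y * punctured_walsh k r' y)
      = (\<Sum>y\<in>{..<2 ^ k} - {0}. walsh k r y * walsh k r' y)"
    by (rule sum.mono_neutral_cong_right) (auto simp: punctured_walsh_def)
  also have "\<dots> = (\<Sum>y<2 ^ k. walsh k r y * walsh k r' y) - 1"
    by (subst sum_diff1) auto
  finally show ?thesis using sum_walsh_mult[OF assms] by simp
qed

lemma sum_punctured_walsh_index:
  assumes "y < 2 ^ k" shows "(\<Sum>r<2 ^ k. punctured_walsh k r y) = 0"
  using sum_walsh_index[OF assms] by (cases "y = 0") (simp_all add: punctured_walsh_def)

lemma sum_walsh_eq_0:
  assumes "0 < r" "r < 2 ^ k" shows "(\<Sum>z<2 ^ k. walsh k r z) = 0"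
  using sum_walsh_mult[of r k 0] assms by simp

lemma sum_triple_product:
  fixes a c e :: "nat \<Rightarrow> real"
  shows "(\<Sum>z\<in>A. \<Sum>p\<in>B. \<Sum>y\<in>C. a z * c p * e y) = (\<Sum>z\<in>A. a z) * (\<Sum>p\<in>B. c p) * (\<Sum>y\<in>C. e y)"
  by (simp flip: sum_distrib_left sum_distrib_right)

lemma sum_wave:
  assumes "i < 2 ^ l" "1 \<le> l"
  shows "(\<Sum>z<2 ^ Suc l. \<Sum>p<R. \<Sum>y<R'. wave l m i r z p y) = 0"
proof -
  have l: "(2::nat) \<le> 2 ^ l" using power_increasing[OF assms(2), of "2::nat"] by simp
  let ?a = "walsh (Suc l) (Suc (2 ^ l))" and ?b = "walsh (Suc l) (Suc i)"
  have "(\<Sum>z<2 ^ Suc l. \<Sum>p<R. \<Sum>y<R'. wave l m i r z p y)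
      = (\<Sum>z<2 ^ Suc l. \<Sum>p<R. \<Sum>y<R'. ?a z * spike (2 ^ l) i p * 1)
      + (\<Sum>z<2 ^ Suc l. \<Sum>p<R. \<Sum>y<R'. ?b z * 1 * punctured_walsh (l + m) r y)"
    by (simp add: wave_def sum.distrib)
  also have "\<dots> = 0"
    unfolding sum_triple_product using l assms sum_walsh_eq_0[of "Suc (2 ^ l)" "Suc l"]
      sum_walsh_eq_0[of "Suc i" "Suc l"] by simp
  finally show ?thesis .
qed

text \<open>
  Expanding the product into four parts: the two mixed parts vanish by the signs in \<open>z\<close>, the
  spikes contribute \<open>J / R\<close> and the punctured Walsh functions \<open>I - J / R\<close>, up to the number of points.
\<close>

lemma sum_wave_mult:
  assumes i: "i < 2 ^ l" "i' < 2 ^ l" and r: "r < 2 ^ (l + m)" "r' < 2 ^ (l + m)" and "1 \<le> l"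
  defines "R \<equiv> 2 ^ (l + m)"
  shows "(\<Sum>z<2 ^ Suc l. \<Sum>p<R. \<Sum>y<R. wave l m i r z p y * wave l m i' r' z p y)
    = (if i = i' \<and> r = r' then real (2 ^ Suc l * R * R) else 0)"
proof -
  have l: "(2::nat) \<le> 2 ^ l" using power_increasing[OF assms(5), of "2::nat"] by simp
  let ?a = "walsh (Suc l) (Suc (2 ^ l))" and ?b = "\<lambda>i. walsh (Suc l) (Suc i)"
  let ?c = "spike (2 ^ l)" and ?e = "punctured_walsh (l + m)"
  let ?S = "\<lambda>f. \<Sum>z<2 ^ Suc l. \<Sum>p<R. \<Sum>y<R. f z p y"
  have aa: "(\<Sum>z<2 ^ Suc l. ?a z * ?a z) = 2 ^ Suc l"
    using l by (subst sum_walsh_mult) auto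
  have ab: "(\<Sum>z<2 ^ Suc l. ?a z * ?b i z) = 0" if "i < 2 ^ l" for i
    using l that by (subst sum_walsh_mult) auto
  have ba: "(\<Sum>z<2 ^ Suc l. ?b i z * ?a z) = 0" if "i < 2 ^ l" for i
    using l that by (subst sum_walsh_mult) auto
  have bb: "(\<Sum>z<2 ^ Suc l. ?b i z * ?b i' z) = (if i = i' then 2 ^ Suc l else 0)"
    using l i by (subst sum_walsh_mult) auto
  have cc: "(\<Sum>p<R. ?c i p * ?c i' p) = (if i = i' then 1 else 0)"
    using i by (intro sum_spike_mult) (auto simp: R_def)
  have ee: "(\<Sum>y<R. ?e r y * ?e r' y) = (if r = r' then real R else 0) - 1"
    using sum_punctured_walsh_mult[OF r] by (simp add: R_def)
  have "?S (\<lambda>z p y. wave l m i r z p y * wave l m i' r' z p y)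
      = ?S (\<lambda>z p y. (?a z * ?a z) * (?c i p * ?c i' p) * 1 + (?a z * ?b i' z) * ?c i p * ?e r' y
          + (?b i z * ?a z) * ?c i' p * ?e r y + (?b i z * ?b i' z) * 1 * (?e r y * ?e r' y))"
    by (intro sum.cong refl) (simp add: wave_def algebra_simps)
  also have "\<dots> = ?S (\<lambda>z p y. (?a z * ?a z) * (?c i p * ?c i' p) * 1) + ?S (\<lambda>z p y. (?a z * ?b i' z) * ?c i p * ?e r' y)
          + ?S (\<lambda>z p y. (?b i z * ?a z) * ?c i' p * ?e r y) + ?S (\<lambda>z p y. (?b i z * ?b i' z) * 1 * (?e r y * ?e r' y))"
    by (simp only: sum.distrib)
  also have "\<dots> = 2 ^ Suc l * (if i = i' then 1 else 0) * real R
      + (if i = i' then 2 ^ Suc l else 0) * real R * ((if r = r' then real R else 0) - 1)"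
    unfolding sum_triple_product aa ab[OF i(2)] ba[OF i(1)] bb cc ee by simp
  also have "\<dots> = (if i = i' \<and> r = r' then real (2 ^ Suc l * R * R) else 0)"
    by (simp add: algebra_simps)
  finally show ?thesis .
qed

text \<open>
  The same functions with the index pair \<open>(i, r)\<close> and the point \<open>(z, p, y)\<close> each encoded in one
  natural number, so that each group occupies \<open>R\<close> consecutive indices.
\<close>

definition packed_wave :: "nat \<Rightarrow> nat \<Rightarrow> nat \<Rightarrow> nat \<Rightarrow> real" where
  "packed_wave l m n w = (let R = 2 ^ (l + m) in
     wave l m (n div R) (n mod R) (w div R div R) (w div R mod R) (w mod R))"

lemma sum_unpack3:
  fixes f :: "nat \<Rightarrow> nat \<Rightarrow> nat \<Rightarrow> real"
  assumes "R > 0"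
  shows "(\<Sum>w<A * R * R. f (w div R div R) (w div R mod R) (w mod R)) = (\<Sum>z<A. \<Sum>p<R. \<Sum>y<R. f z p y)"
proof -
  have "(\<Sum>w<A * R * R. f (w div R div R) (w div R mod R) (w mod R))
      = (\<Sum>u<A * R. \<Sum>y<R. f (u div R) (u mod R) y)"
    by (rule sum_div_mod[OF assms, of "\<lambda>u y. f (u div R) (u mod R) y"])
  also have "\<dots> = (\<Sum>z<A. \<Sum>p<R. \<Sum>y<R. f z p y)"
    by (rule sum_div_mod[OF assms, of "\<lambda>z p. \<Sum>y<R. f z p y"])
  finally show ?thesis .
qed

lemma div_less_index: "n < 2 ^ l * 2 ^ (l + m) \<Longrightarrow> n div 2 ^ (l + m) < (2::nat) ^ l"
  by (simp add: less_mult_imp_div_less)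

lemma abs_packed_wave_le: "n < 2 ^ l * 2 ^ (l + m) \<Longrightarrow> \<bar>packed_wave l m n w\<bar> \<le> 2"
  unfolding packed_wave_def Let_def by (intro abs_wave_le div_less_index)

lemma sum_packed_wave:
  assumes "n < 2 ^ l * 2 ^ (l + m)" "1 \<le> l"
  shows "(\<Sum>w<2 ^ Suc l * 2 ^ (l + m) * 2 ^ (l + m). packed_wave l m n w) = 0"
  unfolding packed_wave_def Let_def
  using sum_unpack3[of "2 ^ (l + m)" "wave l m (n div 2 ^ (l + m)) (n mod 2 ^ (l + m))" "2 ^ Suc l"]
    sum_wave[OF div_less_index[OF assms(1)] assms(2)] by simp

lemma sum_packed_wave_mult:
  assumes n: "n < 2 ^ l * 2 ^ (l + m)" "n' < 2 ^ l * 2 ^ (l + m)" and l: "1 \<le> l"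
  shows "(\<Sum>w<2 ^ Suc l * 2 ^ (l + m) * 2 ^ (l + m). packed_wave l m n w * packed_wave l m n' w)
    = (if n = n' then real (2 ^ Suc l * 2 ^ (l + m) * 2 ^ (l + m)) else 0)"
proof -
  let ?R = "2 ^ (l + m) :: nat"
  have "(\<Sum>w<2 ^ Suc l * ?R * ?R. packed_wave l m n w * packed_wave l m n' w)
      = (\<Sum>z<2 ^ Suc l. \<Sum>p<?R. \<Sum>y<?R. wave l m (n div ?R) (n mod ?R) z p y * wave l m (n' div ?R) (n' mod ?R) z p y)"
    unfolding packed_wave_def Let_def
    by (rule sum_unpack3[of ?R "\<lambda>z p y. wave l m (n div ?R) (n mod ?R) z p y * wave l m (n' div ?R) (n' mod ?R) z p y"]) simp
  also have "\<dots> = (if n div ?R = n' div ?R \<and> n mod ?R = n' mod ?R then real (2 ^ Suc l * ?R * ?R) else 0)"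
    by (intro sum_wave_mult div_less_index n l) auto
  also have "n div ?R = n' div ?R \<and> n mod ?R = n' mod ?R \<longleftrightarrow> n = n'"
    by (metis div_mult_mod_eq)
  finally show ?thesis .
qed

lemma sum_blocks:
  fixes f :: "nat \<Rightarrow> nat \<Rightarrow> real"
  assumes "R > 0"
  shows "(\<Sum>n\<in>{p * R..<L * R}. f (n div R) (n mod R)) = (\<Sum>i\<in>{p..<L}. \<Sum>r<R. f i r)"
proof -
  have "(\<Sum>i\<in>{p..<L}. \<Sum>r<R. f i r) = (\<Sum>(i, r)\<in>{p..<L} \<times> {..<R}. f i r)"
    by (simp add: sum.cartesian_product)
  also have "\<dots> = (\<Sum>n\<in>{p * R..<L * R}. f (n div R) (n mod R))"
    by (rule sum.reindex_bij_witness[of _ "\<lambda>n. (n div R, n mod R)" "\<lambda>(i, r). i * R + r"])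
       (use assms in \<open>auto simp: less_mult_imp_div_less mult.commute intro: combine_lt
          simp: less_eq_div_iff_mult_less_eq trans_le_add1\<close>)
  finally show ?thesis by simp
qed

text \<open>
  The groups \<open>p, \<dots>, 2 ^ l - 1\<close> are summed, that is, the entries of column \<open>p\<close> from the diagonal on. The
  Walsh parts cancel within each group, and each spike is counted \<open>R\<close> times.
\<close>

lemma packed_wave_partial_sum_ge:
  assumes "2 * (w div 2 ^ (l + m) mod 2 ^ (l + m)) < 2 ^ l" and l: "1 \<le> l"
  defines "R \<equiv> 2 ^ (l + m) :: nat"
  shows "\<bar>\<Sum>n\<in>{(w div R mod R) * R..<2 ^ l * R}. packed_wave l m n w\<bar> \<ge> real R * (real l - 1) / 18"
proof -
  define p where "p = w div R mod R"
  have R: "R > 0" by (simp add: R_def)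
  let ?L = "2 ^ l :: nat"
  let ?V = "csc_energy ?L"
  have pL: "2 * p < ?L" using assms(1) by (simp add: p_def R_def)
  have V: "?V > 0" by (intro csc_energy_pos) simp
  let ?z = "w div R div R" and ?y = "w mod R"
  have block: "(\<Sum>r<R. wave l m i r ?z p ?y) = real R * (walsh (Suc l) (Suc ?L) ?z * spike ?L i p)" for i
  proof -
    have "(\<Sum>r<R. punctured_walsh (l + m) r ?y) = 0"
      unfolding R_def by (intro sum_punctured_walsh_index) simp
    then show ?thesis by (simp add: wave_def sum.distrib flip: sum_distrib_left)
  qed
  have "(\<Sum>n\<in>{p * R..<?L * R}. packed_wave l m n w) = (\<Sum>i\<in>{p..<?L}. \<Sum>r<R. wave l m i r ?z p ?y)"
    unfolding packed_wave_def Let_def R_def[symmetric] p_def[symmetric]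
    by (rule sum_blocks[OF R])
  also have "\<dots> = real R * walsh (Suc l) (Suc ?L) ?z * (\<Sum>i\<in>{p..<?L}. spike ?L i p)"
    unfolding block by (simp add: sum_distrib_left mult.assoc)
  also have "(\<Sum>i\<in>{p..<?L}. spike ?L i p) = (\<Sum>i\<in>{p..<?L}. csc_half ?L (int i - int p)) / sqrt ?V"
    using pL by (simp add: spike_def sum_divide_distrib)
  finally have eq: "\<bar>\<Sum>n\<in>{p * R..<?L * R}. packed_wave l m n w\<bar>
      = real R * (\<bar>\<Sum>i\<in>{p..<?L}. csc_half ?L (int i - int p)\<bar> / sqrt ?V)"
    using V by (simp add: abs_mult)
  have "(real l - 1) / 18 \<le> \<bar>\<Sum>i\<in>{p..<?L}. csc_half ?L (int i - int p)\<bar> / sqrt ?V"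
  proof -
    have "ln (real ?L / 2) = (real l - 1) * ln 2"
      by (simp add: ln_div ln_realpow algebra_simps)
    then have tail: "real ?L / pi * ((real l - 1) * ln 2) \<le> (\<Sum>i\<in>{p..<?L}. csc_half ?L (int i - int p))"
      using sum_csc_half_tail_ge[OF pL] by simp
    have "?V \<le> 8 * (real ?L)\<^sup>2" by (rule csc_energy_le)
    also have "\<dots> \<le> 9 * (real ?L)\<^sup>2" by (intro mult_right_mono) auto
    also have "\<dots> = (3 * real ?L)\<^sup>2" by (simp add: power_mult_distrib)
    finally have "?V \<le> (3 * real ?L)\<^sup>2" .
    then have sV: "sqrt ?V \<le> 3 * real ?L" by (intro real_le_lsqrt) auto
    \<comment> \<open>The tail of the column is at least \<open>2 ^ l / pi * ln (2 ^ l / 2)\<close>, and it is divided by the root of the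
      energy, at most \<open>3 * 2 ^ l\<close>.\<close>
    have "1 / 18 \<le> ln 2 / (3 * pi)"
    proof -
      have "3 * pi \<le> 18 * ln 2" using pi_less_4 ln2_ge_two_thirds by linarith
      then show ?thesis by (simp add: field_simps)
    qed
    then have "(real l - 1) * (1 / 18) \<le> (real l - 1) * (ln 2 / (3 * pi))"
      using l by (intro mult_left_mono) auto
    also have "\<dots> = real ?L / pi * ((real l - 1) * ln 2) / (3 * real ?L)" by simp
    also have "\<dots> \<le> real ?L / pi * ((real l - 1) * ln 2) / sqrt ?V"
      using sV V l by (intro divide_left_mono mult_nonneg_nonneg mult_pos_pos) auto
    also have "\<dots> \<le> \<bar>\<Sum>i\<in>{p..<?L}. csc_half ?L (int i - int p)\<bar> / sqrt ?V"
      using tail V by (intro divide_right_mono) auto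
    finally show ?thesis by simp
  qed
  then have "real R * ((real l - 1) / 18) \<le> \<bar>\<Sum>n\<in>{p * R..<?L * R}. packed_wave l m n w\<bar>"
    unfolding eq by (intro mult_left_mono) auto
  then show ?thesis by (simp add: p_def)
qed

text \<open>
  The diagonal position \<open>p\<close> must lie in the left half of the \<open>2 ^ l\<close> columns, so that at least half of
  the column remains; the probability is \<open>2 ^ (l - 1) / 2 ^ (l + m)\<close>.
\<close>

lemma card_large_packed_wave:
  fixes l m :: nat
  assumes "1 \<le> l"
  defines "R \<equiv> 2 ^ (l + m) :: nat"
  shows "real (card {w. w < 2 ^ Suc l * R * R \<and> 2 * (w div R mod R) < 2 ^ l}) / real (2 ^ Suc l * R * R) = 1 / 2 ^ Suc m"
proof -
  have R: "R > 0" by (simp add: R_def)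
  have "real (card {w. w < 2 ^ Suc l * R * R \<and> 2 * (w div R mod R) < 2 ^ l})
      = (\<Sum>w<2 ^ Suc l * R * R. if 2 * (w div R mod R) < 2 ^ l then 1 else 0)"
    by (simp add: sum.If_cases Int_def)
  also have "\<dots> = (\<Sum>z<(2::nat) ^ Suc l. \<Sum>p<R. \<Sum>y<R. if 2 * p < 2 ^ l then 1 else 0)"
    by (rule sum_unpack3[OF R, of "\<lambda>_ p _. if 2 * p < 2 ^ l then 1 else 0"])
  also have "\<dots> = 2 ^ Suc l * real R * (\<Sum>p<R. if 2 * p < 2 ^ l then 1 else 0)"
    by (simp flip: sum_distrib_left)
  also have "(\<Sum>p<R. if 2 * p < 2 ^ l then 1 else 0 :: real) = real (card {p. p < R \<and> 2 * p < 2 ^ l})"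
    by (simp add: sum.If_cases Int_def)
  also have "{p. p < R \<and> 2 * p < 2 ^ l} = {..<2 ^ (l - 1)}"
  proof -
    obtain k where l: "l = Suc k" using assms(1) by (cases l) auto
    have "2 ^ k \<le> R" unfolding R_def l by (intro power_increasing) auto
    then show ?thesis by (auto simp: l)
  qed
  finally have "real (card {w. w < 2 ^ Suc l * R * R \<and> 2 * (w div R mod R) < 2 ^ l})
      = 2 ^ Suc l * real R * 2 ^ (l - 1)" by simp
  moreover have "2 ^ (l - 1) * 2 ^ Suc m = real R"
    using assms(1) by (cases l) (auto simp: R_def power_add)
  ultimately show ?thesis using R by (simp add: field_simps)
qed

section \<open>The logarithmic normalizations\<close>

lemma one_le_ln: "1 \<le> ln t" if "3 \<le> t" for t :: real
  using that exp_le by (subst ln_ge_iff) auto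

text \<open>
  The margin is narrow: \<open>ln 16\<close> is about \<open>2.77\<close>, just above \<open>exp 1\<close>. It is proved through the
  intermediate value \<open>11 / 4\<close>.
\<close>

lemma one_le_ln_ln: "1 \<le> ln (ln t)" if "16 \<le> t" for t :: real
proof -
  have "11 / 16 \<le> ln (2 :: real)"
    using ln_approx_bounds[of 2 2] by (simp add: eval_nat_numeral)
  then have "11 / 4 \<le> 4 * ln (2 :: real)" by simp
  also have "\<dots> = ln (2 ^ 4)" by (subst ln_realpow) auto
  also have "\<dots> \<le> ln t" using that by (intro ln_mono) auto
  finally have "11 / 4 \<le> ln t" .
  moreover have "1 \<le> ln (11 / 4 :: real)"
    using ln_approx_bounds[of "11 / 4" 3] by (simp add: eval_nat_numeral)
  ultimately show ?thesis by (meson ln_mono order_trans zero_less_divide_iff zero_less_numeral)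
qed

lemma nondecreasing_normalization_H_log:
  assumes "0 \<le> \<alpha>" shows "nondecreasing_normalization (H_log \<alpha>)"
proof -
  have ge: "1 \<le> H_log \<alpha> t" if "1 \<le> t" for t
  proof (cases "3 \<le> t")
    case True
    then have "1 * 1 \<le> t powr (1/2) * ln t powr \<alpha>"
      using assms one_le_ln[OF True] by (intro mult_mono ge_one_powr_ge_zero) auto
    then show ?thesis using True by (simp add: H_log_def)
  qed (simp add: H_log_def)
  have mono: "H_log \<alpha> s \<le> H_log \<alpha> t" if "1 \<le> s" "s \<le> t" for s t
  proof (cases "3 \<le> s")
    case True
    then show ?thesis unfolding H_log_def
      using that assms one_le_ln[OF True] by (auto intro!: mult_mono powr_mono2)
  next
    case False
    then have "H_log \<alpha> s = 1" by (simp add: H_log_def)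
    then show ?thesis using ge[of t] that by simp
  qed
  show ?thesis
    unfolding nondecreasing_normalization_def
    using ge mono by (auto intro!: mono_onI)
qed

lemma nondecreasing_normalization_H_loglog:
  assumes "0 \<le> \<beta>" shows "nondecreasing_normalization (H_loglog \<beta>)"
proof -
  have ge: "1 \<le> H_loglog \<beta> t" if "1 \<le> t" for t
  proof (cases "16 \<le> t")
    case True
    then have "1 * 1 * 1 \<le> t powr (1/2) * ln t powr (3/2) * ln (ln t) powr \<beta>"
      using assms one_le_ln[of t] one_le_ln_ln[OF True] by (intro mult_mono ge_one_powr_ge_zero) auto
    then show ?thesis using True by (simp add: H_loglog_def)
  qed (simp add: H_loglog_def)
  have mono: "H_loglog \<beta> s \<le> H_loglog \<beta> t" if "1 \<le> s" "s \<le> t" for s t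
  proof (cases "16 \<le> s")
    case True
    have l: "1 \<le> ln s" "ln s \<le> ln t" using True that one_le_ln[of s] by auto
    moreover have "1 \<le> ln (ln s)" "ln (ln s) \<le> ln (ln t)"
      using one_le_ln_ln[OF True] l by auto
    ultimately show ?thesis unfolding H_loglog_def
      using that True assms by (auto intro!: mult_mono powr_mono2)
  next
    case False
    then have "H_loglog \<beta> s = 1" by (simp add: H_loglog_def)
    then show ?thesis using ge[of t] that by simp
  qed
  show ?thesis
    unfolding nondecreasing_normalization_def
    using ge mono by (auto intro!: mono_onI)
qed

lemma half_le_ln_power: "real j / 2 \<le> ln (2 ^ j)"
  using ln2_ge_two_thirds mult_left_mono[of "1/2" "ln 2" "real j"] by (simp add: ln_realpow)

lemma universal_H_log:
  assumes "\<alpha> > 3/2" shows "universal_upper_class TYPE('a) (H_log \<alpha>)"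
proof (rule universal_upper_class_if_summable)
  show "nondecreasing_normalization (H_log \<alpha>)"
    using assms by (intro nondecreasing_normalization_H_log) simp
  let ?C = "4 * 2 powr (2 * \<alpha>)"
  have "summable (\<lambda>j. ?C * real j powr (2 - 2 * \<alpha>))"
    using assms by (intro summable_mult) (simp add: summable_real_powr_iff)
  then show "summable (\<lambda>j. 2 ^ j * (real j + 1)\<^sup>2 / (H_log \<alpha> (2 ^ j))\<^sup>2)"
  proof (rule summable_comparison_test_ev[rotated])
    show "\<forall>\<^sub>F j in sequentially. norm (2 ^ j * (real j + 1)\<^sup>2 / (H_log \<alpha> (2 ^ j))\<^sup>2)
        \<le> ?C * real j powr (2 - 2 * \<alpha>)"
      using eventually_ge_at_top[of "2 :: nat"]
    proof eventually_elim
      case (elim j)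
      have "(2::real) ^ 2 \<le> 2 ^ j" using elim by (intro power_increasing) auto
      then have "H_log \<alpha> (2 ^ j) = (2 ^ j) powr (1/2) * ln (2 ^ j) powr \<alpha>" by (simp add: H_log_def)
      then have "(H_log \<alpha> (2 ^ j))\<^sup>2 = 2 ^ j * ln (2 ^ j) powr (2 * \<alpha>)"
        by (simp add: power_mult_distrib powr_half_sqrt flip: powr_numeral)
           (simp add: powr_powr mult.commute)
      then have "2 ^ j * (real j + 1)\<^sup>2 / (H_log \<alpha> (2 ^ j))\<^sup>2 = (real j + 1)\<^sup>2 / ln (2 ^ j) powr (2 * \<alpha>)"
        by simp
      also have "\<dots> \<le> (2 * real j)\<^sup>2 / (real j / 2) powr (2 * \<alpha>)"
        using elim half_le_ln_power[of j] assms
        by (intro frac_le power_mono powr_mono2) auto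
      also have "\<dots> = ?C * real j powr (2 - 2 * \<alpha>)"
        using elim by (simp add: powr_divide powr_diff power_mult_distrib flip: powr_numeral)
      finally show ?case by simp
    qed
  qed
qed

text \<open>
  The binary logarithm in place of the natural one makes Cauchy condensation exact: the condensed
  series is \<open>\<Sum>k. 1 / (k + 1) powr s\<close>.
\<close>

lemma summable_floor_log_powr:
  assumes "s > 1" shows "summable (\<lambda>j. 1 / (2 ^ floor_log j * (real (floor_log j) + 1) powr s))"
proof -
  have "summable (\<lambda>k. real (Suc k) powr (- s))"
    using assms by (subst summable_Suc_iff) (simp add: summable_real_powr_iff)
  also have "(\<lambda>k. real (Suc k) powr (- s)) = (\<lambda>k. 2 ^ k * (1 / (2 ^ floor_log (2 ^ k) * (real (floor_log (2 ^ k)) + 1) powr s)))"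
    by (auto simp: powr_minus_divide add.commute)
  finally show ?thesis
    using assms floor_log_le_iff
    by (subst condensation_test) (auto intro!: divide_left_mono mult_mono powr_mono2 power_increasing)
qed

lemma universal_H_loglog:
  assumes "\<beta> > 1/2" shows "universal_upper_class TYPE('a) (H_loglog \<beta>)"
proof (rule universal_upper_class_if_summable)
  show "nondecreasing_normalization (H_loglog \<beta>)"
    using assms by (intro nondecreasing_normalization_H_loglog) simp
  let ?C = "32 * 6 powr (2 * \<beta>)"
  have "summable (\<lambda>j. ?C * (1 / (2 ^ floor_log j * (real (floor_log j) + 1) powr (2 * \<beta>))))"
    using assms by (intro summable_mult summable_floor_log_powr) simp
  then show "summable (\<lambda>j. 2 ^ j * (real j + 1)\<^sup>2 / (H_loglog \<beta> (2 ^ j))\<^sup>2)"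
  proof (rule summable_comparison_test_ev[rotated])
    show "\<forall>\<^sub>F j in sequentially. norm (2 ^ j * (real j + 1)\<^sup>2 / (H_loglog \<beta> (2 ^ j))\<^sup>2)
        \<le> ?C * (1 / (2 ^ floor_log j * (real (floor_log j) + 1) powr (2 * \<beta>)))"
      using eventually_ge_at_top[of "4 :: nat"]
    proof eventually_elim
      case (elim j)
      define k where "k = floor_log j"
      have k: "2 ^ k \<le> j" "2 \<le> k"
        using elim floor_log_exp2_le[of j] floor_log_le_iff[OF elim] floor_log_power[of 2] by (auto simp: k_def)
      have kj: "2 ^ k \<le> real j" using of_nat_mono[OF k(1), where 'a = real] by simp
      have "(2::real) ^ 4 \<le> 2 ^ j" using elim by (intro power_increasing) auto
      then have t: "(16::real) \<le> 2 ^ j" by simp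
      define s where "s = ln ((2::real) ^ j)"
      have s: "real j / 2 \<le> s" "1 \<le> ln s"
        using half_le_ln_power[of j] one_le_ln_ln[OF t] by (auto simp: s_def)
      have ln_s: "(real k + 1) / 6 \<le> ln s"
      proof -
        have "real (k - 1) / 2 \<le> ln (2 ^ (k - 1))" by (rule half_le_ln_power)
        also have "\<dots> \<le> ln s"
        proof (rule ln_mono)
          have "(2::real) ^ (k - 1) * 2 = 2 ^ k" using k by (cases k) auto
          then show "2 ^ (k - 1) \<le> s" using kj s by linarith
        qed simp_all
        finally show ?thesis using k by (simp add: of_nat_diff)
      qed
      have "H_loglog \<beta> (2 ^ j) = (2 ^ j) powr (1/2) * s powr (3/2) * ln s powr \<beta>"
        using t by (simp add: H_loglog_def s_def)
      then have "(H_loglog \<beta> (2 ^ j))\<^sup>2 = 2 ^ j * (s powr 3 * ln s powr (2 * \<beta>))"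
        by (simp add: power_mult_distrib powr_half_sqrt flip: powr_numeral)
           (simp add: powr_powr mult.commute)
      then have "2 ^ j * (real j + 1)\<^sup>2 / (H_loglog \<beta> (2 ^ j))\<^sup>2 = (real j + 1)\<^sup>2 / (s powr 3 * ln s powr (2 * \<beta>))"
        by simp
      also have "\<dots> \<le> (2 * real j)\<^sup>2 / ((real j / 2) powr 3 * ((real k + 1) / 6) powr (2 * \<beta>))"
        using elim s ln_s assms
        by (intro frac_le power_mono mult_mono powr_mono2) auto
      also have "\<dots> = ?C * (1 / (real j * (real k + 1) powr (2 * \<beta>)))"
        using elim by (simp add: powr_divide field_simps power2_eq_square power3_eq_cube)
      also have "\<dots> \<le> ?C * (1 / (2 ^ k * (real k + 1) powr (2 * \<beta>)))"
        using kj elim by (intro mult_left_mono divide_left_mono mult_right_mono mult_pos_pos) auto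
      finally show ?case by (simp add: k_def)
    qed
  qed
qed

text \<open>
  Almost everywhere the limit superior of the ratio would be both infinite and, by the big-O bound,
  finite, which is impossible on a space of positive measure.
\<close>

lemma rigid_counterexample_not_universal:
  assumes rigid: "rigid_counterexample H M F f g"
  shows "\<not> universal_upper_class TYPE(real) H"
proof
  assume univ: "universal_upper_class TYPE(real) H"
  have sys: "admissible_system M F f g" and H: "nondecreasing_normalization H"
    using rigid unfolding rigid_counterexample_def by blast+
  interpret admissible_system M F f g by (rule sys)
  have f: "f k = 1/2" and g: "g k = 1" if "k \<ge> 1" for k
    using rigid that unfolding rigid_counterexample_def by blast+
  have env: "1 \<le> envelope H f g N" if "N \<ge> 1" for N
  proof -
    have "0 \<le> Phi g N" unfolding Phi_def by (intro sum_nonneg) (simp add: g)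
    then have "1 \<le> H (Phi g N + 1)"
      using H by (auto simp: nondecreasing_normalization_def)
    moreover have "f 1 \<le> Max (f ` {1..N})" using that by (intro Max_ge) auto
    ultimately show ?thesis using f[of 1] by (simp add: envelope_def)
  qed
  have "AE x in M. (\<lambda>N. Dev F f N x) \<in> O[sequentially](envelope H f g)"
    using univ sys by (auto simp: universal_upper_class_def)
  moreover have "AE x in M. limsup (\<lambda>N. ereal (\<bar>Dev F f N x\<bar> / envelope H f g N)) = \<infinity>"
    using rigid unfolding rigid_counterexample_def by blast
  ultimately have "AE x in M. False"
  proof eventually_elim
    case (elim x)
    from elim(1) obtain c where "\<forall>\<^sub>F N in sequentially. norm (Dev F f N x) \<le> c * norm (envelope H f g N)"
      by (elim landau_o.bigE)
    then have "\<forall>\<^sub>F N in sequentially. ereal (\<bar>Dev F f N x\<bar> / envelope H f g N) \<le> ereal c"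
      using eventually_ge_at_top[of "1 :: nat"]
    proof eventually_elim
      case (elim N)
      then show ?case using env[of N] by (simp add: divide_le_eq)
    qed
    then have "limsup (\<lambda>N. ereal (\<bar>Dev F f N x\<bar> / envelope H f g N)) \<le> ereal c"
      by (rule Limsup_bounded)
    then show False using elim(2) by simp
  qed
  then obtain B where "space M \<subseteq> B" "emeasure M B = 0" "B \<in> sets M" by (auto elim!: AE_E)
  then have "emeasure M (space M) = 0" by (metis emeasure_mono le_zero_eq)
  then show False using measure_pos by (simp add: measure_def)
qed

section \<open>The counterexample\<close>

text \<open>
  Cauchy condensation removes the outer binary logarithm.
\<close>

lemma summable_floor_log_exponent_iff:
  assumes "mono e"
  shows "summable (\<lambda>j. 1 / 2 ^ (floor_log j + e (floor_log j)) :: real) \<longleftrightarrow> summable (\<lambda>k. 1 / 2 ^ e k :: real)"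
proof -
  have "summable (\<lambda>j. 1 / 2 ^ (floor_log j + e (floor_log j)) :: real)
      \<longleftrightarrow> summable (\<lambda>k. 2 ^ k * (1 / 2 ^ (floor_log (2 ^ k) + e (floor_log (2 ^ k)))) :: real)"
    using assms floor_log_le_iff
    by (intro condensation_test) (auto intro!: divide_left_mono power_increasing add_mono monoD[of e])
  also have "(\<lambda>k. 2 ^ k * (1 / 2 ^ (floor_log (2 ^ k) + e (floor_log (2 ^ k)))) :: real) = (\<lambda>k. 1 / 2 ^ e k)"
    by (simp add: power_add)
  finally show ?thesis .
qed

text \<open>
  Events of probability \<open>2 ^ -(spread j)\<close> have a divergent sum, but only just: \<open>2 ^ spread j\<close> is of the
  order of \<open>j * ln j * ln (ln j)\<close>. The last factor tends to infinity and produces an infinite limit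
  superior at the critical exponent instead of a merely positive one.
\<close>

definition spread :: "nat \<Rightarrow> nat" where
  "spread j = floor_log j + (floor_log (floor_log j) + floor_log (floor_log (floor_log j)))"

lemma not_summable_spread: "\<not> summable (\<lambda>j. 1 / 2 ^ Suc (spread j) :: real)"
proof
  assume "summable (\<lambda>j. 1 / 2 ^ Suc (spread j) :: real)"
  then have "summable (\<lambda>j. 2 * (1 / 2 ^ Suc (spread j)) :: real)" by (rule summable_mult)
  then have "summable (\<lambda>j. 1 / 2 ^ spread j :: real)" by simp
  then have "summable (\<lambda>k. 1 / 2 ^ (floor_log k + floor_log (floor_log k)) :: real)"
    unfolding spread_def
    using summable_floor_log_exponent_iff[of "\<lambda>k. floor_log k + floor_log (floor_log k)"]
    by (simp add: monoI add_mono floor_log_le_iff)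
  then have "summable (\<lambda>k. 1 / 2 ^ floor_log k :: real)"
    using summable_floor_log_exponent_iff[of floor_log] by (simp add: floor_log_mono)
  then have "summable (\<lambda>k :: nat. 1 :: real)"
    using summable_floor_log_exponent_iff[of "\<lambda>_. 0"] by (simp add: monoI)
  then show False using summable_LIMSEQ_zero LIMSEQ_unique tendsto_const zero_neq_one by blast
qed

lemma spread_mono: "i \<le> j \<Longrightarrow> spread i \<le> spread j"
  unfolding spread_def by (intro add_mono floor_log_le_iff)

definition group_size :: "nat \<Rightarrow> nat" where "group_size j = 2 ^ (Suc j + spread j)"

definition block_length :: "nat \<Rightarrow> nat" where "block_length j = 2 ^ Suc j * group_size j"

definition block_states :: "nat \<Rightarrow> nat" where
  "block_states j = 2 ^ Suc (Suc j) * group_size j * group_size j"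

interpretation menshov: digit_blocks block_length block_states "\<lambda>j. packed_wave (Suc j) (spread j)"
proof
  show "0 < block_length j" "0 < block_states j" for j
    by (simp_all add: block_length_def block_states_def group_size_def)
  fix j n n' w
  assume n: "n < block_length j"
  then show "\<bar>packed_wave (Suc j) (spread j) n w\<bar> \<le> 2"
    unfolding block_length_def group_size_def by (rule abs_packed_wave_le)
  show "(\<Sum>w<block_states j. packed_wave (Suc j) (spread j) n w) = 0"
    using n unfolding block_length_def block_states_def group_size_def by (rule sum_packed_wave) simp
  assume "n' < block_length j"
  then show "(\<Sum>w<block_states j. packed_wave (Suc j) (spread j) n w * packed_wave (Suc j) (spread j) n' w)
      = (if n = n' then real (block_states j) else 0)"
    using n unfolding block_length_def block_states_def group_size_def by (intro sum_packed_wave_mult) auto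
qed

text \<open>
  The block lengths grow at least by the factor \<open>4\<close>, so that the last block dominates all earlier
  ones together.
\<close>

lemma start_Suc_le: "menshov.start (Suc j) \<le> 2 * block_length j"
proof (induction j)
  case 0
  then show ?case by (simp add: menshov.start_def)
next
  case (Suc j)
  have "4 * block_length j \<le> 2 ^ 2 * block_length j * 2 ^ (spread (Suc j) - spread j)" by simp
  also have "\<dots> = 2 ^ (2 + (Suc j + (Suc j + spread j)) + (spread (Suc j) - spread j))"
    by (simp only: power_add block_length_def group_size_def mult_ac)
  also have "2 + (Suc j + (Suc j + spread j)) + (spread (Suc j) - spread j) = Suc (Suc j) + (Suc (Suc j) + spread (Suc j))"
    using spread_mono[of j "Suc j"] by simp
  also have "2 ^ (Suc (Suc j) + (Suc (Suc j) + spread (Suc j))) = block_length (Suc j)"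
    by (simp only: power_add block_length_def group_size_def)
  finally show ?case using Suc by (simp add: menshov.start_Suc)
qed

text \<open>
  With \<open>n = block_length j\<close> one has \<open>n * 2 ^ spread j = (group_size j)\<^sup>2\<close>, while \<open>ln n\<close> is of order \<open>j\<close>
  and \<open>ln (ln n)\<close> of order \<open>ln j\<close>. The square of the normalization is thus of order
  \<open>n * j ^ 3 * ln j\<close>, and \<open>j * ln j\<close> is, up to a constant, \<open>2 ^ spread j\<close> divided by its last factor.
\<close>

lemma H_loglog_block_square_le:
  assumes j: "2 \<le> j"
  shows "(H_loglog (1/2) (3 * real (block_length j)))\<^sup>2
    \<le> 52488 * (real (group_size j) * real j)\<^sup>2 / 2 ^ floor_log (floor_log (floor_log j))"
proof -
  define k where "k = floor_log j"
  define h where "h = floor_log k"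
  define q where "q = floor_log h"
  define T where "T = 3 * real (block_length j)"
  have spread: "spread j = k + (h + q)" by (simp add: spread_def k_def h_def q_def)
  have k: "1 \<le> k" "2 ^ k \<le> j" "j < 2 * 2 ^ k"
    using j floor_log_le_iff[OF j] floor_log_power[of 1] floor_log_exp2_le[of j] floor_log_exp2_gt[of j]
    by (auto simp: k_def)
  have h: "k < 2 * 2 ^ h" using floor_log_exp2_gt[of k] by (simp add: h_def)
  have le: "floor_log n \<le> n" for n
    by (cases "n = 0") (auto intro: order_trans[OF less_imp_le[OF less_exp] floor_log_exp2_le])
  have hq: "h \<le> j" "q \<le> j" "k \<le> j"
    using le[of j] le[of k] le[of h] by (auto simp: k_def h_def q_def)
  have T_pow: "T \<le> 2 ^ (9 * j)"
  proof -
    have "T \<le> 2 ^ 2 * 2 ^ (Suc j + (Suc j + spread j))"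
      by (simp add: T_def block_length_def group_size_def power_add)
    also have "\<dots> = 2 ^ (2 + (Suc j + (Suc j + spread j)))" by (simp only: power_add)
    also have "\<dots> \<le> 2 ^ (9 * j)" using j hq spread by (intro power_increasing) auto
    finally show ?thesis .
  qed
  have T16: "16 \<le> T"
  proof -
    have "(2::real) ^ (3 + 3) \<le> 2 ^ (Suc j + (Suc j + spread j))"
      using j by (intro power_increasing) auto
    then show ?thesis by (simp add: T_def block_length_def group_size_def power_add)
  qed
  have lnT: "1 \<le> ln T" "ln T \<le> 9 * real j"
  proof -
    show "1 \<le> ln T" using T16 by (intro one_le_ln) simp
    have "ln T \<le> ln (2 ^ (9 * j))" using T_pow T16 by (intro ln_mono) auto
    also have "\<dots> = 9 * real j * ln 2" by (simp add: ln_realpow)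
    also have "\<dots> \<le> 9 * real j * 1" using ln_2_less_1 by (intro mult_left_mono) auto
    finally show "ln T \<le> 9 * real j" by simp
  qed
  have lnlnT: "1 \<le> ln (ln T)" "ln (ln T) \<le> 6 * real k"
  proof -
    show "1 \<le> ln (ln T)" using T16 by (rule one_le_ln_ln)
    have "9 * j \<le> 2 ^ 4 * (2 * 2 ^ k)" using k by simp
    also have "\<dots> = 2 ^ (k + 5)" by (simp add: power_add)
    finally have "real (9 * j) \<le> real (2 ^ (k + 5))" by (rule of_nat_mono)
    then have "ln T \<le> 2 ^ (k + 5)" using lnT by simp
    then have "ln (ln T) \<le> ln (2 ^ (k + 5))" using lnT by (intro ln_mono) auto
    also have "\<dots> = real (k + 5) * ln 2" by (rule ln_realpow)
    also have "\<dots> \<le> real (k + 5) * 1" using ln_2_less_1 by (intro mult_left_mono) auto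
    also have "\<dots> \<le> 6 * real k" using k by simp
    finally show "ln (ln T) \<le> 6 * real k" .
  qed
  have "(H_loglog (1/2) T)\<^sup>2 = (sqrt T)\<^sup>2 * (ln T powr (3/2))\<^sup>2 * (sqrt (ln (ln T)))\<^sup>2"
  proof -
    have "0 \<le> T" "0 \<le> ln (ln T)" using T16 lnlnT by linarith+
    then have "ln (ln T) powr (1/2) = sqrt (ln (ln T))" "T powr (1/2) = sqrt T"
      by (simp_all only: powr_half_sqrt)
    then show ?thesis using T16 by (simp add: H_loglog_def power_mult_distrib)
  qed
  also have "(ln T powr (3/2))\<^sup>2 = ln T powr 3"
    by (simp add: powr_powr flip: powr_numeral)
  also have "(sqrt T)\<^sup>2 * ln T powr 3 * (sqrt (ln (ln T)))\<^sup>2 = T * (ln T powr 3 * ln (ln T))"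
  proof -
    have "0 \<le> T" "0 \<le> ln (ln T)" using T16 lnlnT by linarith+
    then show ?thesis by (simp only: real_sqrt_pow2 mult_ac)
  qed
  also have "\<dots> \<le> T * ((9 * real j) powr 3 * (6 * real k))"
    using T16 lnT lnlnT by (intro mult_left_mono mult_mono powr_mono2) auto
  also have "\<dots> = 13122 * (real (block_length j) * real j ^ 3 * real k)"
    using j k by (simp add: T_def power3_eq_cube)
  also have "\<dots> \<le> 13122 * (real (block_length j) * (real j)\<^sup>2 * (4 * 2 ^ k * 2 ^ h))"
  proof -
    have "real j * real k \<le> (2 * 2 ^ k) * (2 * 2 ^ h)"
      using of_nat_mono[OF less_imp_le[OF k(3)], where 'a = real] of_nat_mono[OF less_imp_le[OF h], where 'a = real]
      by (intro mult_mono) auto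
    then have "real (block_length j) * (real j)\<^sup>2 * (real j * real k) \<le> real (block_length j) * (real j)\<^sup>2 * (4 * 2 ^ k * 2 ^ h)"
      by (intro mult_left_mono) auto
    then show ?thesis by (simp add: power2_eq_square power3_eq_cube mult_ac)
  qed
  also have "\<dots> = 52488 * (real (group_size j) * real j)\<^sup>2 / 2 ^ q"
  proof -
    have "real (block_length j) * 2 ^ k * 2 ^ h * 2 ^ q = (real (group_size j))\<^sup>2"
      by (simp add: block_length_def group_size_def spread power_add power2_eq_square)
    then show ?thesis by (simp add: field_simps power_mult_distrib)
  qed
  finally show ?thesis by (simp add: T_def k_def h_def q_def)
qed

lemma eventually_H_loglog_block_le:
  "\<forall>\<^sub>F j in sequentially. C * H_loglog (1/2) (3 * real (block_length j)) \<le> real (group_size j) * real j"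
proof -
  have fl: "filterlim floor_log at_top sequentially"
    unfolding filterlim_at_top eventually_sequentially
    by (metis floor_log_le_iff floor_log_power)
  have "filterlim (\<lambda>j. floor_log (floor_log (floor_log j))) at_top sequentially"
    by (intro filterlim_compose[OF fl] fl)
  moreover obtain q0 where q0: "52488 * C\<^sup>2 \<le> 2 ^ q0"
    using real_arch_pow[of 2 "52488 * C\<^sup>2"] by (auto intro: less_imp_le)
  ultimately have "\<forall>\<^sub>F j in sequentially. q0 \<le> floor_log (floor_log (floor_log j))"
    by (simp add: filterlim_at_top)
  then show ?thesis using eventually_ge_at_top[of 2]
  proof eventually_elim
    case (elim j)
    let ?q = "floor_log (floor_log (floor_log j))"
    have "(2::real) ^ q0 \<le> 2 ^ ?q" using elim by (intro power_increasing) auto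
    with q0 have "52488 * C\<^sup>2 \<le> 2 ^ ?q" by (rule order_trans)
    then have C: "52488 * C\<^sup>2 / 2 ^ ?q \<le> 1" by (simp add: divide_le_eq)
    have "(C * H_loglog (1/2) (3 * real (block_length j)))\<^sup>2
        = C\<^sup>2 * (H_loglog (1/2) (3 * real (block_length j)))\<^sup>2"
      by (rule power_mult_distrib)
    also have "\<dots> \<le> C\<^sup>2 * (52488 * (real (group_size j) * real j)\<^sup>2 / 2 ^ ?q)"
      using elim(2) by (intro mult_left_mono H_loglog_block_square_le) simp_all
    also have "\<dots> = (52488 * C\<^sup>2 / 2 ^ ?q) * (real (group_size j) * real j)\<^sup>2" by simp
    also have "\<dots> \<le> 1 * (real (group_size j) * real j)\<^sup>2" by (intro mult_right_mono C) simp
    also have "\<dots> = (real (group_size j) * real j)\<^sup>2" by (rule mult_1)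
    finally show ?case by (rule power2_le_imp_le) simp
  qed
qed

text \<open>
  The joined functions are bounded by \<open>2\<close>, so that the quarter of them added to \<open>1/2\<close> stays in
  \<open>{0..1}\<close>. Indices are shifted by one because \<open>joined\<close> starts at \<open>0\<close>.
\<close>

definition menshov_F :: "nat \<Rightarrow> real \<Rightarrow> real" where
  "menshov_F k x = 1 / 2 + menshov.joined (k - 1) x / 4"

lemma menshov_F_Suc: "menshov_F (Suc i) x - 1 / 2 = menshov.joined i x / 4"
  unfolding menshov_F_def diff_Suc_1 by (rule add_diff_cancel_left')

lemma sum_menshov_F:
  "(\<Sum>k\<in>{m<..n}. menshov_F k x - 1 / 2) = (\<Sum>i\<in>{m..<n}. menshov.joined i x) / 4"
proof -
  have "(\<Sum>k\<in>{m<..n}. menshov_F k x - 1 / 2) = (\<Sum>i\<in>{m..<n}. menshov_F (Suc i) x - 1 / 2)"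
    by (rule sum.reindex_bij_witness[of _ Suc "\<lambda>k. k - 1"]) auto
  then show ?thesis unfolding menshov_F_Suc sum_divide_distrib .
qed

lemma Dev_menshov: "Dev menshov_F (\<lambda>_. 1 / 2) N x = (\<Sum>n<N. menshov.joined n x) / 4"
proof -
  have "{1..N} = {0<..N}" "{..<N} = {0..<N}" by auto
  then show ?thesis unfolding Dev_def by (simp only: sum_menshov_F)
qed

lemma integral_menshov_square:
  assumes "m < n"
  shows "integrable unit_measure (\<lambda>x. (\<Sum>k\<in>{m<..n}. menshov_F k x - 1 / 2)\<^sup>2)"
    and "(\<integral>x. (\<Sum>k\<in>{m<..n}. menshov_F k x - 1 / 2)\<^sup>2 \<partial>unit_measure) = 1 / 16 * (real n - real m)"
proof -
  have sq: "(\<Sum>k\<in>{m<..n}. menshov_F k x - 1 / 2)\<^sup>2 = 1 / 16 * (\<Sum>i\<in>{m..<n}. menshov.joined i x)\<^sup>2" for x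
    unfolding sum_menshov_F by (simp add: power_divide)
  show "integrable unit_measure (\<lambda>x. (\<Sum>k\<in>{m<..n}. menshov_F k x - 1 / 2)\<^sup>2)"
    unfolding sq by (intro integrable_mult_right menshov.integral_sum_joined_square) simp
  show "(\<integral>x. (\<Sum>k\<in>{m<..n}. menshov_F k x - 1 / 2)\<^sup>2 \<partial>unit_measure) = 1 / 16 * (real n - real m)"
    unfolding sq integral_mult_right_zero using assms
    by (subst menshov.integral_sum_joined_square) (auto simp: of_nat_diff)
qed

lemma menshov_F_bounds: "0 \<le> menshov_F k x" "menshov_F k x \<le> 1"
  using menshov.abs_joined_le[of "k - 1" x] by (auto simp: menshov_F_def abs_le_iff)

lemma menshov_F_measurable: "menshov_F k \<in> borel_measurable unit_measure"
proof -
  have "(\<lambda>x. menshov_F k x) \<in> borel_measurable unit_measure"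
    unfolding menshov_F_def by measurable
  then show ?thesis by simp
qed

lemma Phi_one: "Phi (\<lambda>_. 1) N = real N"
  by (simp add: Phi_def)

lemma admissible_menshov: "admissible_system unit_measure menshov_F (\<lambda>_. 1 / 2) (\<lambda>_. 1)"
proof -
  interpret finite_measure unit_measure by (rule finite_unit_measure)
  show ?thesis
  proof
    show "0 < measure unit_measure (space unit_measure)" using measure_unit_measure by simp
    show "menshov_F k \<in> borel_measurable unit_measure" for k by (rule menshov_F_measurable)
    show "0 \<le> menshov_F k x" for k x by (rule menshov_F_bounds)
    show "filterlim (Phi (\<lambda>_. 1)) at_top sequentially"
      unfolding Phi_one[abs_def] by (rule filterlim_real_sequentially)
    show "\<exists>K>0. \<forall>m n. 1 \<le> m \<and> m < n \<longrightarrow>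
      (\<integral>\<^sup>+x. ennreal ((Dev menshov_F (\<lambda>_. 1 / 2) n x - Dev menshov_F (\<lambda>_. 1 / 2) m x)\<^sup>2) \<partial>unit_measure)
        \<le> ennreal (K * (Phi (\<lambda>_. 1) n - Phi (\<lambda>_. 1) m))"
    proof (intro exI[of _ "1 / 16"] conjI allI impI)
      fix m n :: nat assume mn: "1 \<le> m \<and> m < n"
      have "Dev menshov_F (\<lambda>_. 1 / 2) n x - Dev menshov_F (\<lambda>_. 1 / 2) m x = (\<Sum>k\<in>{m<..n}. menshov_F k x - 1 / 2)" for x
        using Phi_diff[of m n "\<lambda>k. menshov_F k x - 1 / 2"] mn by (simp add: Dev_eq_Phi)
      then have "(\<integral>\<^sup>+x. ennreal ((Dev menshov_F (\<lambda>_. 1 / 2) n x - Dev menshov_F (\<lambda>_. 1 / 2) m x)\<^sup>2) \<partial>unit_measure)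
          = (\<integral>\<^sup>+x. ennreal ((\<Sum>k\<in>{m<..n}. menshov_F k x - 1 / 2)\<^sup>2) \<partial>unit_measure)"
        by simp
      also have "\<dots> = ennreal (1 / 16 * (real n - real m))"
        using mn integral_menshov_square[of m n] by (subst nn_integral_eq_integral) auto
      finally show "(\<integral>\<^sup>+x. ennreal ((Dev menshov_F (\<lambda>_. 1 / 2) n x - Dev menshov_F (\<lambda>_. 1 / 2) m x)\<^sup>2) \<partial>unit_measure)
          \<le> ennreal (1 / 16 * (Phi (\<lambda>_. 1) n - Phi (\<lambda>_. 1) m))"
        by (simp add: Phi_one)
    qed simp
  qed auto
qed

text \<open>
  The large partial sum of a block is a difference of two deviations, so at least one of these is
  half as large.
\<close>

lemma Dev_large_if_digit:
  assumes "2 * (menshov.digit j x div group_size j mod group_size j) < 2 ^ Suc j"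
  shows "\<exists>N\<ge>menshov.start j. N \<le> menshov.start (Suc j) \<and>
    real (group_size j) * real j / 144 \<le> \<bar>Dev menshov_F (\<lambda>_. 1 / 2) N x\<bar>"
proof -
  define w where "w = menshov.digit j x"
  define p where "p = w div group_size j mod group_size j"
  let ?S = "menshov.start j" and ?D = "\<lambda>N. Dev menshov_F (\<lambda>_. 1 / 2) N x"
  have p: "p * group_size j \<le> block_length j"
    using assms unfolding p_def w_def block_length_def by (intro mult_le_mono1) linarith
  have "?D (?S + block_length j) - ?D (?S + p * group_size j)
      = (\<Sum>n\<in>{?S + p * group_size j..<?S + block_length j}. menshov.joined n x) / 4"
    using p by (simp add: Dev_menshov lessThan_atLeast0 sum_diff_nat_ivl flip: diff_divide_distrib)
  also have "(\<Sum>n\<in>{?S + p * group_size j..<?S + block_length j}. menshov.joined n x)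
      = (\<Sum>n\<in>{p * group_size j..<block_length j}. packed_wave (Suc j) (spread j) n w)"
    by (rule sum.reindex_bij_witness[of _ "\<lambda>n. ?S + n" "\<lambda>n. n - ?S"])
       (auto simp: w_def menshov.joined_start[symmetric])
  finally have increment: "?D (?S + block_length j) - ?D (?S + p * group_size j)
      = (\<Sum>n\<in>{p * group_size j..<block_length j}. packed_wave (Suc j) (spread j) n w) / 4" .
  have "\<bar>?D (?S + block_length j) - ?D (?S + p * group_size j)\<bar>
      = \<bar>\<Sum>n\<in>{p * group_size j..<block_length j}. packed_wave (Suc j) (spread j) n w\<bar> / 4"
    by (simp only: increment abs_divide abs_numeral)
  moreover have "real (group_size j) * real j / 18
      \<le> \<bar>\<Sum>n\<in>{p * group_size j..<block_length j}. packed_wave (Suc j) (spread j) n w\<bar>"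
    using packed_wave_partial_sum_ge[of w "Suc j" "spread j"] assms
    by (simp add: p_def w_def block_length_def group_size_def del: power_Suc)
  ultimately have "real (group_size j) * real j / 72 \<le> \<bar>?D (?S + block_length j) - ?D (?S + p * group_size j)\<bar>"
    by simp
  also have "\<dots> \<le> \<bar>?D (?S + block_length j)\<bar> + \<bar>?D (?S + p * group_size j)\<bar>"
    by (rule abs_triangle_ineq4)
  finally have "real (group_size j) * real j / 144 \<le> \<bar>?D (?S + block_length j)\<bar>
      \<or> real (group_size j) * real j / 144 \<le> \<bar>?D (?S + p * group_size j)\<bar>"
    by linarith
  then show ?thesis
  proof
    assume "real (group_size j) * real j / 144 \<le> \<bar>?D (?S + block_length j)\<bar>"
    then show ?thesis by (intro exI[of _ "?S + block_length j"]) (simp add: menshov.start_Suc)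
  next
    assume "real (group_size j) * real j / 144 \<le> \<bar>?D (?S + p * group_size j)\<bar>"
    then show ?thesis using p by (intro exI[of _ "?S + p * group_size j"]) (simp add: menshov.start_Suc)
  qed
qed

lemma limsup_eq_infinity_if_unbounded:
  assumes "\<And>C N0. \<exists>N\<ge>N0. C \<le> u N"
  shows "limsup (\<lambda>N. ereal (u N)) = \<infinity>"
proof -
  have "(SUP N\<in>{N0..}. ereal (u N)) = \<infinity>" for N0
    by (rule SUP_PInfty) (use assms in auto)
  then show ?thesis by (simp add: limsup_INF_SUP)
qed

text \<open>
  In each of the infinitely many blocks with a favourable digit there is an index whose deviation is at
  least a constant times \<open>group_size j * j\<close>. This exceeds any multiple of the normalization at the end of
  the block, hence of its value at that index.
\<close>

lemma rigid_counterexample_menshov: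
  assumes H: "nondecreasing_normalization H"
    and dominated: "\<And>t. 16 \<le> t \<Longrightarrow> H t \<le> H_loglog (1/2) t"
  shows "rigid_counterexample H unit_measure menshov_F (\<lambda>_. 1 / 2) (\<lambda>_. 1)"
proof -
  let ?D = "Dev menshov_F (\<lambda>_. 1 / 2)" and ?E = "envelope H (\<lambda>_. 1 / 2) (\<lambda>_. 1)"
  have loglog: "mono_on {1..} (H_loglog (1/2))" "H_loglog (1/2) \<in> {1..} \<rightarrow> {1..}"
    using nondecreasing_normalization_H_loglog[of "1/2"] unfolding nondecreasing_normalization_def by auto
  have "AE x in unit_measure. \<exists>\<^sub>F j in sequentially.
      menshov.digit j x \<in> {w. 2 * (w div group_size j mod group_size j) < 2 ^ Suc j}"
  proof (rule menshov.AE_frequently_digit)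
    have "real (card {w. w < block_states j \<and> w \<in> {w. 2 * (w div group_size j mod group_size j) < 2 ^ Suc j}})
        / real (block_states j) = 1 / 2 ^ Suc (spread j)" for j
      using card_large_packed_wave[of "Suc j" "spread j"]
      by (simp add: block_states_def group_size_def del: power_Suc)
    then show "\<not> summable (\<lambda>j. real (card {w. w < block_states j \<and> w \<in> {w. 2 * (w div group_size j mod group_size j) < 2 ^ Suc j}})
        / real (block_states j))"
      using not_summable_spread by simp
  qed
  then have limsup: "AE x in unit_measure. limsup (\<lambda>N. ereal (\<bar>?D N x\<bar> / ?E N)) = \<infinity>"
  proof eventually_elim
    case (elim x)
    show ?case
    proof (rule limsup_eq_infinity_if_unbounded)
      fix C :: real and N0 :: nat
      \<comment> \<open>The factor is \<open>432 = 3 * 144\<close>: the denominator is at most three times the normalization, and the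
        deviation is at least \<open>group_size j * j / 144\<close>.\<close>
      have "\<forall>\<^sub>F j in sequentially. (432 * \<bar>C\<bar>) * H_loglog (1/2) (3 * real (block_length j))
          \<le> real (group_size j) * real j \<and> max N0 16 \<le> j"
        by (intro eventually_conj eventually_H_loglog_block_le eventually_ge_at_top)
      from frequently_eventually_frequently[OF elim this] obtain j
        where j: "2 * (menshov.digit j x div group_size j mod group_size j) < 2 ^ Suc j"
          and growth: "(432 * \<bar>C\<bar>) * H_loglog (1/2) (3 * real (block_length j)) \<le> real (group_size j) * real j"
          and large: "N0 \<le> j" "16 \<le> j"
        by (auto dest!: frequently_ex)
      obtain N where N: "menshov.start j \<le> N" "N \<le> menshov.start (Suc j)"
          "real (group_size j) * real j / 144 \<le> \<bar>?D N x\<bar>"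
        using Dev_large_if_digit[OF j] by blast
      have jN: "j \<le> N" using N(1) menshov.start_ge[of j] by simp
      have "N + 1 \<le> 3 * block_length j"
        using N(2) start_Suc_le[of j] menshov.len_pos[of j] by linarith
      then have T: "real N + 1 \<le> 3 * real (block_length j)"
        using of_nat_mono[of "N + 1" "3 * block_length j", where 'a = real] by simp
      let ?T = "3 * real (block_length j)"
      have "H (real N + 1) \<le> H_loglog (1/2) (real N + 1)"
        using jN large by (intro dominated) simp
      also have "\<dots> \<le> H_loglog (1/2) ?T"
        using T by (intro mono_onD[OF loglog(1)]) auto
      finally have HN: "H (real N + 1) \<le> H_loglog (1/2) ?T" .
      have T1: "1 \<le> H_loglog (1/2) ?T" using T funcset_mem[OF loglog(2), of ?T] by simp
      have "(\<lambda>_::nat. 1 / 2 :: real) ` {1..N} = {1 / 2}"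
        by (rule image_constant[of 1]) (use jN large in simp)
      then have E: "?E N = H (real N + 1) + 3 / 2" by (simp add: envelope_def Phi_one)
      have "1 \<le> H (real N + 1)" using H funcset_mem[of H "{1..}" "{1..}" "real N + 1"]
        unfolding nondecreasing_normalization_def by auto
      then have E_pos: "0 < ?E N" unfolding E by simp
      have "C * ?E N \<le> \<bar>C\<bar> * ?E N" using E_pos by (intro mult_right_mono) auto
      also have "\<dots> \<le> \<bar>C\<bar> * (3 * H_loglog (1/2) ?T)"
        using HN T1 unfolding E by (intro mult_left_mono) auto
      also have "\<dots> \<le> real (group_size j) * real j / 144" using growth by simp
      also have "\<dots> \<le> \<bar>?D N x\<bar>" by (rule N(3))
      finally have "C \<le> \<bar>?D N x\<bar> / ?E N" using E_pos by (simp add: le_divide_eq)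
      then show "\<exists>N\<ge>N0. C \<le> \<bar>?D N x\<bar> / ?E N" using jN large by (intro exI[of _ N]) auto
    qed
  qed
  have mean: "(\<integral>x. menshov_F k x \<partial>unit_measure) = 1 / 2" for k
  proof -
    have int: "integrable unit_measure (\<lambda>x. menshov.joined (k - 1) x)"
      by (rule finite_measure.integrable_const_bound[OF finite_unit_measure, of _ 2])
         (auto simp: menshov.abs_joined_le menshov.joined_measurable)
    have "integrable unit_measure (\<lambda>x. 1 / 2 :: real)"
      using finite_measure.integrable_const[OF finite_unit_measure] .
    then show ?thesis
      unfolding menshov_F_def using int measure_unit_measure
      by (subst Bochner_Integration.integral_add) (auto simp: menshov.integral_joined)
  qed
  show ?thesis
    unfolding rigid_counterexample_def
  proof (intro conjI allI impI ballI)
    show "nondecreasing_normalization H" by (rule H)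
    show "admissible_system unit_measure menshov_F (\<lambda>_. 1 / 2) (\<lambda>_. 1)" by (rule admissible_menshov)
    show "0 \<le> menshov_F k x" "menshov_F k x \<le> 1" for k x by (rule menshov_F_bounds)+
    show "1 / 2 = (\<integral>x. menshov_F k x \<partial>unit_measure)" for k by (rule mean[symmetric])
    show "\<exists>K>0. \<forall>m n. 1 \<le> m \<and> m < n \<longrightarrow>
        (\<integral>x. (\<Sum>k\<in>{m<..n}. menshov_F k x - 1 / 2)\<^sup>2 \<partial>unit_measure) = K * (real n - real m)"
    proof (intro exI[of _ "1 / 16"] conjI allI impI)
      show "(\<integral>x. (\<Sum>k\<in>{m<..n}. menshov_F k x - 1 / 2)\<^sup>2 \<partial>unit_measure) = 1 / 16 * (real n - real m)"
        if "1 \<le> m \<and> m < n" for m n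
        using that by (intro integral_menshov_square(2)) simp
    qed simp
    show "AE x in unit_measure. limsup (\<lambda>N. ereal (\<bar>?D N x\<bar> / ?E N)) = \<infinity>" by (rule limsup)
  qed (rule refl)+
qed

lemma H_log_le_H_loglog:
  assumes "\<alpha> \<le> 3/2" "16 \<le> t" shows "H_log \<alpha> t \<le> H_loglog (1/2) t"
proof -
  have "1 \<le> ln t" using assms by (intro one_le_ln) linarith
  then have "t powr (1/2) * ln t powr \<alpha> \<le> t powr (1/2) * ln t powr (3/2)"
    using assms(1) by (intro mult_left_mono powr_mono) simp_all
  also have "\<dots> \<le> t powr (1/2) * ln t powr (3/2) * ln (ln t) powr (1/2)"
    using ge_one_powr_ge_zero[OF one_le_ln_ln[OF assms(2)], of "1/2"]
    by (simp only: mult_le_cancel_left1) (simp add: mult_less_0_iff)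
  finally show ?thesis using assms(2) by (simp only: H_log_def H_loglog_def) simp
qed

lemma H_loglog_mono_exponent:
  assumes "\<beta> \<le> \<gamma>" "16 \<le> t" shows "H_loglog \<beta> t \<le> H_loglog \<gamma> t"
  using assms(2) powr_mono[OF assms(1) one_le_ln_ln[OF assms(2)]]
  by (simp only: H_loglog_def if_True) (intro mult_left_mono mult_nonneg_nonneg powr_ge_zero)

theorem corollary1:
  shows "(\<forall>\<alpha>\<ge>0. (universal_upper_class TYPE(real) (H_log \<alpha>) \<longleftrightarrow> \<alpha> > 3/2) \<and>
                 (\<alpha> > 3/2 \<longrightarrow> universal_upper_class TYPE('a) (H_log \<alpha>))) \<and>
         (\<forall>\<beta>\<ge>0. (universal_upper_class TYPE(real) (H_loglog \<beta>) \<longleftrightarrow> \<beta> > 1/2) \<and>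
                 (\<beta> > 1/2 \<longrightarrow> universal_upper_class TYPE('a) (H_loglog \<beta>))) \<and>
         (\<forall>\<alpha>. 0 \<le> \<alpha> \<and> \<alpha> \<le> 3/2 \<longrightarrow>
            (\<exists>M F f g. rigid_counterexample (H_log \<alpha>) M F f g)) \<and>
         (\<forall>\<beta>. 0 \<le> \<beta> \<and> \<beta> \<le> 1/2 \<longrightarrow>
            (\<exists>M F f g. rigid_counterexample (H_loglog \<beta>) M F f g))"
proof -
  have log: "\<exists>M F f g. rigid_counterexample (H_log \<alpha>) M F f g" if "0 \<le> \<alpha>" "\<alpha> \<le> 3/2" for \<alpha>
    using rigid_counterexample_menshov[OF nondecreasing_normalization_H_log[OF that(1)] H_log_le_H_loglog[OF that(2)]]
    by blast
  have loglog: "\<exists>M F f g. rigid_counterexample (H_loglog \<beta>) M F f g" if "0 \<le> \<beta>" "\<beta> \<le> 1/2" for \<beta>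
    using rigid_counterexample_menshov[OF nondecreasing_normalization_H_loglog[OF that(1)] H_loglog_mono_exponent[OF that(2)]]
    by blast
  have "universal_upper_class TYPE(real) (H_log \<alpha>) \<longleftrightarrow> \<alpha> > 3/2" if "0 \<le> \<alpha>" for \<alpha>
    using log[OF that] rigid_counterexample_not_universal universal_H_log by (metis not_le)
  moreover have "universal_upper_class TYPE(real) (H_loglog \<beta>) \<longleftrightarrow> \<beta> > 1/2" if "0 \<le> \<beta>" for \<beta>
    using loglog[OF that] rigid_counterexample_not_universal universal_H_loglog by (metis not_le)
  ultimately show ?thesis
    by (intro conjI allI impI) (simp_all add: log loglog universal_H_log universal_H_loglog)
qed

end
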